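(* Let $d\ge 1$ and $q\ge 2$, let $\mathfrak A$ be a $d$-colored ordinal, and put $k=|\rho_{q-1}(\mathfrak A)|$. Then there is a $d$-colored ordinal $\mathfrak B$ such that $\mathfrak B\equiv_q\mathfrak A$ and $\operatorname{otp}(B)\le\omega^k$.
   Context: A $d$-colored ordinal is a structure $\mathfrak A=(A,<,C_0,\dots,C_{d-1})$ where $(A,<)$ is an ordinal (well-order) and the unary predicates $C_i$ partition $A$; empty domains and empty color classes are allowed. $\operatorname{otp}(A)$ is the order type of $(A,<)$. $\mathfrak A\equiv_q\mathfrak B$ means agreement on all first-order sentences of quantifier rank at most $q$. $[[\mathfrak A]]^q$ denotes the $q$-characteristic sentence of $\mathfrak A$, so $[[\mathfrak A]]^q$ and $[[\mathfrak B]]^q$ are identified iff $\mathfrak A\equiv_q\mathfrak B$. For $a\in A$ of color $i$, the $q$-character of $a$ is $\rho_q^{\mathfrak A}(a)=(i,[[\mathfrak A_{<a}]]^q,[[\mathfrak A_{>a}]]^q)$, where $\mathfrak A_{<a},\mathfrak A_{>a}$ are the substructures on $\{b:b<a\}$ and $\{b:b>a\}$; and $\rho_q(\mathfrak A)=\{\rho_q^{\mathfrak A}(a):a\in A\}$. *)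

theory Defs
  imports Main "HOL-Library.Disjoint_Sets"
begin

unbundle cardinal_syntax

section \<open>Colored ordinals\<close>

text \<open>
  The order is stored as its reflexive version, following the library's theory of
  well-order relations; the symbol \<open><\<close> of the formal language is interpreted by its strict part.
  Only the color classes with index below the number \<open>d\<close> of colors carry meaning.
\<close>

record 'a colored =
  carr :: "'a set"
  ordr :: "'a rel"
  colr :: "nat \<Rightarrow> 'a set"

definition colored_ordinal :: "nat \<Rightarrow> 'a colored \<Rightarrow> bool" where
  "colored_ordinal d S \<longleftrightarrow>
     well_order_on (carr S) (ordr S) \<and>
     (\<Union>i<d. colr S i) = carr S \<and> disjoint_family_on (colr S) {..<d}"

definition lt :: "'a colored \<Rightarrow> 'a \<Rightarrow> 'a \<Rightarrow> bool" where
  "lt S a b \<longleftrightarrow> (a, b) \<in> ordr S \<and> a \<noteq> b"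

definition substr :: "'a colored \<Rightarrow> 'a set \<Rightarrow> 'a colored" where
  "substr S X =
     \<lparr>carr = carr S \<inter> X, ordr = Restr (ordr S) (carr S \<inter> X), colr = (\<lambda>i. colr S i \<inter> X)\<rparr>"

definition below :: "'a colored \<Rightarrow> 'a \<Rightarrow> 'a colored" where
  "below S a = substr S {b \<in> carr S. lt S b a}"

definition above :: "'a colored \<Rightarrow> 'a \<Rightarrow> 'a colored" where
  "above S a = substr S {b \<in> carr S. lt S a b}"


section \<open>First-order logic\<close>

datatype fm =
    Falsum
  | Eq nat nat
  | Less nat nat
  | Color nat nat  \<comment> \<open>\<open>Color i x\<close>: the element \<open>x\<close> has color \<open>i\<close>\<close>
  | Neg fm
  | And fm fm
  | Or fm fm
  | Ex nat fm
  | All nat fm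

primrec sat :: "'a colored \<Rightarrow> (nat \<Rightarrow> 'a) \<Rightarrow> fm \<Rightarrow> bool" where
  "sat S e Falsum = False"
| "sat S e (Eq x y) = (e x = e y)"
| "sat S e (Less x y) = lt S (e x) (e y)"
| "sat S e (Color i x) = (e x \<in> colr S i)"
| "sat S e (Neg \<phi>) = (\<not> sat S e \<phi>)"
| "sat S e (And \<phi> \<psi>) = (sat S e \<phi> \<and> sat S e \<psi>)"
| "sat S e (Or \<phi> \<psi>) = (sat S e \<phi> \<or> sat S e \<psi>)"
| "sat S e (Ex x \<phi>) = (\<exists>a\<in>carr S. sat S (e(x := a)) \<phi>)"
| "sat S e (All x \<phi>) = (\<forall>a\<in>carr S. sat S (e(x := a)) \<phi>)"

primrec fv :: "fm \<Rightarrow> nat set" where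
  "fv Falsum = {}"
| "fv (Eq x y) = {x, y}"
| "fv (Less x y) = {x, y}"
| "fv (Color i x) = {x}"
| "fv (Neg \<phi>) = fv \<phi>"
| "fv (And \<phi> \<psi>) = fv \<phi> \<union> fv \<psi>"
| "fv (Or \<phi> \<psi>) = fv \<phi> \<union> fv \<psi>"
| "fv (Ex x \<phi>) = fv \<phi> - {x}"
| "fv (All x \<phi>) = fv \<phi> - {x}"

primrec colors :: "fm \<Rightarrow> nat set" where
  "colors Falsum = {}"
| "colors (Eq x y) = {}"
| "colors (Less x y) = {}"
| "colors (Color i x) = {i}"
| "colors (Neg \<phi>) = colors \<phi>"
| "colors (And \<phi> \<psi>) = colors \<phi> \<union> colors \<psi>"
| "colors (Or \<phi> \<psi>) = colors \<phi> \<union> colors \<psi>"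
| "colors (Ex x \<phi>) = colors \<phi>"
| "colors (All x \<phi>) = colors \<phi>"

primrec qrank :: "fm \<Rightarrow> nat" where
  "qrank Falsum = 0"
| "qrank (Eq x y) = 0"
| "qrank (Less x y) = 0"
| "qrank (Color i x) = 0"
| "qrank (Neg \<phi>) = qrank \<phi>"
| "qrank (And \<phi> \<psi>) = max (qrank \<phi>) (qrank \<psi>)"
| "qrank (Or \<phi> \<psi>) = max (qrank \<phi>) (qrank \<psi>)"
| "qrank (Ex x \<phi>) = Suc (qrank \<phi>)"
| "qrank (All x \<phi>) = Suc (qrank \<phi>)"

definition sentence :: "nat \<Rightarrow> fm \<Rightarrow> bool" where
  "sentence d \<phi> \<longleftrightarrow> fv \<phi> = {} \<and> colors \<phi> \<subseteq> {..<d}"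

text \<open>
  For sentences the truth value does not depend on the assignment (lemma \<open>sat_cong\<close>), so the
  quantifier below is harmless; assignments are total even when the carrier is empty.
\<close>

definition models :: "'a colored \<Rightarrow> fm \<Rightarrow> bool" where
  "models S \<phi> \<longleftrightarrow> (\<forall>e. sat S e \<phi>)"

definition equiv_q :: "nat \<Rightarrow> nat \<Rightarrow> 'a colored \<Rightarrow> 'b colored \<Rightarrow> bool" where
  "equiv_q d q S T \<longleftrightarrow>
     (\<forall>\<phi>. sentence d \<phi> \<and> qrank \<phi> \<le> q \<longrightarrow> (models S \<phi> \<longleftrightarrow> models T \<phi>))"

lemma sat_cong: "(\<And>x. x \<in> fv \<phi> \<Longrightarrow> e x = e' x) \<Longrightarrow> sat S e \<phi> \<longleftrightarrow> sat S e' \<phi>"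
proof (induction \<phi> arbitrary: e e')
  case (Ex x \<phi>)
  have "sat S (e(x := a)) \<phi> \<longleftrightarrow> sat S (e'(x := a)) \<phi>" for a
    by (rule Ex.IH) (use Ex.prems in auto)
  then show ?case by simp
next
  case (All x \<phi>)
  have "sat S (e(x := a)) \<phi> \<longleftrightarrow> sat S (e'(x := a)) \<phi>" for a
    by (rule All.IH) (use All.prems in auto)
  then show ?case by simp
next
  case (Neg \<phi>)
  have "sat S e \<phi> \<longleftrightarrow> sat S e' \<phi>"
    by (rule Neg.IH) (use Neg.prems in auto)
  then show ?case by simp
next
  case (And \<phi> \<psi>)
  have "sat S e \<phi> \<longleftrightarrow> sat S e' \<phi>"
    by (rule And.IH(1)) (use And.prems in auto)
  moreover have "sat S e \<psi> \<longleftrightarrow> sat S e' \<psi>"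
    by (rule And.IH(2)) (use And.prems in auto)
  ultimately show ?case by simp
next
  case (Or \<phi> \<psi>)
  have "sat S e \<phi> \<longleftrightarrow> sat S e' \<phi>"
    by (rule Or.IH(1)) (use Or.prems in auto)
  moreover have "sat S e \<psi> \<longleftrightarrow> sat S e' \<psi>"
    by (rule Or.IH(2)) (use Or.prems in auto)
  ultimately show ?case by simp
qed auto

lemma models_iff_sat: "sentence d \<phi> \<Longrightarrow> models S \<phi> \<longleftrightarrow> sat S e \<phi>"
  unfolding sentence_def models_def using sat_cong[of \<phi>] by blast


section \<open>Characteristic sentences and characters\<close>

text \<open>
  Conjunction and disjunction of a finite set of formulas. The choice of an enumeration depends
  on the set only, so equal sets yield the same formula.
\<close>

definition enum :: "fm set \<Rightarrow> fm list" where
  "enum F = (SOME xs. set xs = F)"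

definition big_And :: "fm set \<Rightarrow> fm" where
  "big_And F = foldr And (enum F) (Neg Falsum)"

definition big_Or :: "fm set \<Rightarrow> fm" where
  "big_Or F = foldr Or (enum F) Falsum"

definition atoms :: "nat \<Rightarrow> nat \<Rightarrow> fm set" where
  "atoms d n = {Eq x y |x y. x < n \<and> y < n} \<union> {Less x y |x y. x < n \<and> y < n}
     \<union> {Color i x |i x. i < d \<and> x < n}"

definition literals :: "nat \<Rightarrow> 'a colored \<Rightarrow> 'a list \<Rightarrow> fm set" where
  "literals d S as =
     {\<phi> \<in> atoms d (length as). sat S (nth as) \<phi>} \<union>
     Neg ` {\<phi> \<in> atoms d (length as). \<not> sat S (nth as) \<phi>}"

text \<open>
  \<open>hintikka d q S [a\<^sub>0, \<dots>, a\<^sub>n\<^sub>-\<^sub>1]\<close> is the Hintikka formula of rank \<open>q\<close> of the tuple, in the free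
  variables \<open>0, \<dots>, n - 1\<close>. There are only finitely many such formulas for fixed \<open>d\<close>, \<open>q\<close>, \<open>n\<close>
  (lemma \<open>finite_hintikka\<close>), so the conjunctions and disjunctions are over finite sets even
  when the carrier is infinite.
\<close>

primrec hintikka :: "nat \<Rightarrow> nat \<Rightarrow> 'a colored \<Rightarrow> 'a list \<Rightarrow> fm" where
  "hintikka d 0 S as = big_And (literals d S as)"
| "hintikka d (Suc q) S as =
     And (big_And ((\<lambda>a. Ex (length as) (hintikka d q S (as @ [a]))) ` carr S))
         (All (length as) (big_Or ((\<lambda>a. hintikka d q S (as @ [a])) ` carr S)))"

definition char_sentence :: "nat \<Rightarrow> nat \<Rightarrow> 'a colored \<Rightarrow> fm" where
  "char_sentence d q S = hintikka d q S []"

definition color_of :: "nat \<Rightarrow> 'a colored \<Rightarrow> 'a \<Rightarrow> nat" where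
  "color_of d S a = (THE i. i < d \<and> a \<in> colr S i)"

definition character :: "nat \<Rightarrow> nat \<Rightarrow> 'a colored \<Rightarrow> 'a \<Rightarrow> nat \<times> fm \<times> fm" where
  "character d q S a =
     (color_of d S a, char_sentence d q (below S a), char_sentence d q (above S a))"

definition characters :: "nat \<Rightarrow> nat \<Rightarrow> 'a colored \<Rightarrow> (nat \<times> fm \<times> fm) set" where
  "characters d q S = character d q S ` carr S"

lemma set_enum: "finite F \<Longrightarrow> set (enum F) = F"
  unfolding enum_def by (rule someI_ex) (rule finite_list)

lemma sat_big_And: "finite F \<Longrightarrow> sat S e (big_And F) \<longleftrightarrow> (\<forall>\<phi>\<in>F. sat S e \<phi>)"
proof -
  have "sat S e (foldr And xs (Neg Falsum)) \<longleftrightarrow> (\<forall>\<phi>\<in>set xs. sat S e \<phi>)" for xs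
    by (induction xs) auto
  then show "finite F \<Longrightarrow> ?thesis" by (simp add: big_And_def set_enum)
qed

lemma sat_big_Or: "finite F \<Longrightarrow> sat S e (big_Or F) \<longleftrightarrow> (\<exists>\<phi>\<in>F. sat S e \<phi>)"
proof -
  have "sat S e (foldr Or xs Falsum) \<longleftrightarrow> (\<exists>\<phi>\<in>set xs. sat S e \<phi>)" for xs
    by (induction xs) auto
  then show "finite F \<Longrightarrow> ?thesis" by (simp add: big_Or_def set_enum)
qed

lemma big_And_inject:
  assumes "finite F" "finite G" "big_And F = big_And G" shows "F = G"
proof -
  have "foldr And xs (Neg Falsum) = foldr And ys (Neg Falsum) \<Longrightarrow> xs = ys" for xs ys
  proof (induction xs arbitrary: ys)
    case Nil then show ?case by (cases ys) auto
  next
    case (Cons x xs) then show ?case by (cases ys) auto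
  qed
  then show ?thesis using assms set_enum unfolding big_And_def by metis
qed

lemma big_Or_inject:
  assumes "finite F" "finite G" "big_Or F = big_Or G" shows "F = G"
proof -
  have "foldr Or xs Falsum = foldr Or ys Falsum \<Longrightarrow> xs = ys" for xs ys
  proof (induction xs arbitrary: ys)
    case Nil then show ?case by (cases ys) auto
  next
    case (Cons x xs) then show ?case by (cases ys) auto
  qed
  then show ?thesis using assms set_enum unfolding big_Or_def by metis
qed

lemma finite_atoms: "finite (atoms d n)"
proof -
  have "atoms d n \<subseteq> (\<lambda>(x, y). Eq x y) ` ({..<n} \<times> {..<n})
      \<union> (\<lambda>(x, y). Less x y) ` ({..<n} \<times> {..<n}) \<union> (\<lambda>(i, x). Color i x) ` ({..<d} \<times> {..<n})"
    by (auto simp: atoms_def)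
  then show ?thesis by (rule finite_subset) auto
qed

lemma finite_literals: "finite (literals d S as)"
  using finite_atoms by (auto simp: literals_def)

lemma finite_hintikka: "finite {hintikka d q S as |(S :: 'a colored) as. length as = n}"
proof (induction q arbitrary: n)
  case 0
  have "{hintikka d 0 S as |(S :: 'a colored) as. length as = n}
      \<subseteq> big_And ` Pow (atoms d n \<union> Neg ` atoms d n)"
    by (auto simp: literals_def intro!: imageI)
  then show ?case by (rule finite_subset) (simp add: finite_atoms)
next
  case (Suc q)
  let ?H = "{hintikka d q S as |(S :: 'a colored) as. length as = Suc n}"
  have "hintikka d (Suc q) S as \<in> (\<lambda>X. And (big_And (Ex n ` X)) (All n (big_Or X))) ` Pow ?H"
    if "length as = n" for S :: "'a colored" and as
    by (rule image_eqI[where x = "(\<lambda>a. hintikka d q S (as @ [a])) ` carr S"])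
      (use that in \<open>force simp: image_image\<close>)+
  then have "{hintikka d (Suc q) S as |(S :: 'a colored) as. length as = n}
      \<subseteq> (\<lambda>X. And (big_And (Ex n ` X)) (All n (big_Or X))) ` Pow ?H"
    by blast
  then show ?case by (rule finite_subset) (simp add: Suc)
qed

lemma finite_hintikka_ext: "finite ((\<lambda>a. hintikka d q S (as @ [a])) ` A)"
  by (rule finite_subset[OF _ finite_hintikka[of d q "Suc (length as)"]]) force

lemma finite_Ex_hintikka: "finite ((\<lambda>a. Ex n (hintikka d q S (as @ [a]))) ` A)"
  using finite_imageI[OF finite_hintikka_ext, of "Ex n" d q S as A] by (simp add: image_image)

lemma foldr_syntax:
  "fv (foldr And xs (Neg Falsum)) = (\<Union>\<phi>\<in>set xs. fv \<phi>)"
  "fv (foldr Or xs Falsum) = (\<Union>\<phi>\<in>set xs. fv \<phi>)"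
  "colors (foldr And xs (Neg Falsum)) = (\<Union>\<phi>\<in>set xs. colors \<phi>)"
  "colors (foldr Or xs Falsum) = (\<Union>\<phi>\<in>set xs. colors \<phi>)"
  "qrank (foldr And xs (Neg Falsum)) \<le> q \<longleftrightarrow> (\<forall>\<phi>\<in>set xs. qrank \<phi> \<le> q)"
  "qrank (foldr Or xs Falsum) \<le> q \<longleftrightarrow> (\<forall>\<phi>\<in>set xs. qrank \<phi> \<le> q)"
  by (induction xs) auto

lemma hintikka_syntax:
  "fv (hintikka d q S as) \<subseteq> {..<length as} \<and> colors (hintikka d q S as) \<subseteq> {..<d}
     \<and> qrank (hintikka d q S as) \<le> q"
proof (induction q arbitrary: as)
  case 0
  have "fv \<phi> \<subseteq> {..<length as} \<and> colors \<phi> \<subseteq> {..<d} \<and> qrank \<phi> = 0"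
    if "\<phi> \<in> literals d S as" for \<phi>
    using that by (auto simp: literals_def atoms_def)
  moreover from this have "qrank (foldr And (enum (literals d S as)) (Neg Falsum)) \<le> 0"
    unfolding foldr_syntax by (simp add: set_enum finite_literals)
  ultimately show ?case
    by (simp add: big_And_def foldr_syntax set_enum finite_literals UN_subset_iff)
next
  case (Suc q)
  have "fv (hintikka d q S (as @ [a])) \<subseteq> insert (length as) {..<length as}" for a
    using Suc[of "as @ [a]"] by (auto simp: lessThan_Suc)
  with Suc show ?case
    by (auto simp: big_And_def big_Or_def foldr_syntax set_enum
        finite_hintikka_ext finite_Ex_hintikka; blast)
qed

lemma sentence_char_sentence:
  "sentence d (char_sentence d q S)" "qrank (char_sentence d q S) \<le> q"
  using hintikka_syntax[of d q S "[]"] by (auto simp: sentence_def char_sentence_def)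

lemma sat_hintikka:
  "(\<And>i. i < length as \<Longrightarrow> e i = as ! i) \<Longrightarrow> sat S e (hintikka d q S as)"
proof (induction q arbitrary: e as)
  case 0
  have "sat S e \<phi> \<longleftrightarrow> sat S (nth as) \<phi>" if "\<phi> \<in> atoms d (length as)" for \<phi>
    by (rule sat_cong) (use that 0 in \<open>auto simp: atoms_def\<close>)
  then have "\<forall>\<phi>\<in>literals d S as. sat S e \<phi>" by (auto simp: literals_def)
  then show ?case by (simp add: sat_big_And finite_literals)
next
  case (Suc q)
  have "sat S (e(length as := a)) (hintikka d q S (as @ [a]))" for a
    by (rule Suc.IH) (use Suc.prems in \<open>auto simp: nth_append less_Suc_eq\<close>)
  then show ?case
    by (auto simp: sat_big_And sat_big_Or finite_hintikka_ext finite_Ex_hintikka)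
qed

lemma hintikka_eq_if_sat:
  fixes S :: "'a colored" and T :: "'b colored"
  assumes "sat T e (hintikka d q S as)" "length as = length bs"
    and "\<And>i. i < length bs \<Longrightarrow> e i = bs ! i"
  shows "hintikka d q S as = hintikka d q T bs"
  using assms
proof (induction q arbitrary: e as bs)
  case 0
  have e: "sat T e \<phi> \<longleftrightarrow> sat T (nth bs) \<phi>" if "\<phi> \<in> atoms d (length bs)" for \<phi>
    by (rule sat_cong) (use that 0 in \<open>auto simp: atoms_def\<close>)
  have *: "\<forall>\<phi>\<in>literals d S as. sat T e \<phi>"
    using 0(1) by (simp add: sat_big_And finite_literals)
  then have "sat S (nth as) \<phi> \<longleftrightarrow> sat T (nth bs) \<phi>" if "\<phi> \<in> atoms d (length bs)" for \<phi>
  proof (cases "sat S (nth as) \<phi>")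
    case True
    then have "\<phi> \<in> literals d S as" using that 0(2) by (simp add: literals_def)
    with True show ?thesis using * e[OF that] by blast
  next
    case False
    then have "Neg \<phi> \<in> literals d S as" using that 0(2) by (simp add: literals_def)
    with False show ?thesis using * e[OF that] by fastforce
  qed
  then have "literals d S as = literals d T bs"
    unfolding literals_def 0(2) by blast
  then show ?case by simp
next
  case (Suc q)
  let ?n = "length bs"
  have IH: "hintikka d q S (as @ [a]) = hintikka d q T (bs @ [b])"
    if "sat T (e(?n := b)) (hintikka d q S (as @ [a]))" for a b
    by (rule Suc.IH[OF that]) (use Suc.prems in \<open>auto simp: nth_append less_Suc_eq\<close>)
  have 1: "\<exists>b\<in>carr T. hintikka d q S (as @ [a]) = hintikka d q T (bs @ [b])" if "a \<in> carr S" for a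
  proof -
    have "\<exists>b\<in>carr T. sat T (e(?n := b)) (hintikka d q S (as @ [a]))"
      using Suc.prems(1,2) that by (auto simp: sat_big_And finite_Ex_hintikka)
    then show ?thesis using IH by blast
  qed
  have 2: "\<exists>a\<in>carr S. hintikka d q S (as @ [a]) = hintikka d q T (bs @ [b])" if "b \<in> carr T" for b
  proof -
    have "\<exists>a\<in>carr S. sat T (e(?n := b)) (hintikka d q S (as @ [a]))"
      using Suc.prems(1,2) that by (auto simp: sat_big_Or finite_hintikka_ext)
    then show ?thesis using IH by blast
  qed
  have "(\<lambda>a. hintikka d q S (as @ [a])) ` carr S = (\<lambda>b. hintikka d q T (bs @ [b])) ` carr T" (is "?X = ?Y")
  proof
    show "?X \<subseteq> ?Y" using 1 by auto
    show "?Y \<subseteq> ?X" using 2 by (metis (mono_tags, lifting) image_eqI image_subsetI)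
  qed
  moreover from arg_cong[OF this, of "image (Ex ?n)"]
  have "(\<lambda>a. Ex ?n (hintikka d q S (as @ [a]))) ` carr S
      = (\<lambda>b. Ex ?n (hintikka d q T (bs @ [b]))) ` carr T"
    by (simp add: image_image)
  ultimately show ?case using Suc.prems(2) by simp
qed

lemma hintikka_Suc_eqD:
  fixes S :: "'a colored" and T :: "'b colored"
  assumes "hintikka d (Suc q) S as = hintikka d (Suc q) T bs"
  shows "(\<lambda>a. hintikka d q S (as @ [a])) ` carr S = (\<lambda>b. hintikka d q T (bs @ [b])) ` carr T"
  using assms by (auto dest!: big_Or_inject[OF finite_hintikka_ext finite_hintikka_ext])

lemma hintikka_eq_atoms:
  fixes S :: "'a colored" and T :: "'b colored"
  assumes "hintikka d q S as = hintikka d q T bs" "length as = length bs"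
    and "set as \<subseteq> carr S" "set bs \<subseteq> carr T" "\<phi> \<in> atoms d (length as)"
  shows "sat S (nth as) \<phi> \<longleftrightarrow> sat T (nth bs) \<phi>"
  using assms
proof (induction q arbitrary: as bs)
  case 0
  then have "literals d S as = literals d T bs"
    by (auto dest!: big_And_inject[OF finite_literals finite_literals])
  moreover have "Neg \<psi> \<notin> atoms d n" for \<psi> n by (auto simp: atoms_def)
  ultimately show ?case using 0(2,5) unfolding literals_def by blast
next
  case (Suc q)
  have "as \<noteq> []" using Suc.prems(5) by (auto simp: atoms_def)
  then have "carr S \<noteq> {}" using Suc.prems(3) by auto
  with hintikka_Suc_eqD[OF Suc.prems(1)] obtain a b where
    ab: "a \<in> carr S" "b \<in> carr T" "hintikka d q S (as @ [a]) = hintikka d q T (bs @ [b])"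
    by blast
  have "sat S (nth (as @ [a])) \<phi> \<longleftrightarrow> sat T (nth (bs @ [b])) \<phi>"
    by (rule Suc.IH[OF ab(3)]) (use Suc.prems ab in \<open>auto simp: atoms_def\<close>)
  moreover have "sat S (nth (as @ [a])) \<phi> \<longleftrightarrow> sat S (nth as) \<phi>"
    "sat T (nth (bs @ [b])) \<phi> \<longleftrightarrow> sat T (nth bs) \<phi>"
    by (rule sat_cong, use Suc.prems(2,5) in \<open>auto simp: atoms_def nth_append\<close>)+
  ultimately show ?case by simp
qed

lemma sat_eq_if_hintikka_eq:
  fixes S :: "'a colored" and T :: "'b colored"
  assumes "hintikka d q S as = hintikka d q T bs" "length as = length bs"
    and "set as \<subseteq> carr S" "set bs \<subseteq> carr T"
    and "qrank \<phi> \<le> q" "colors \<phi> \<subseteq> {..<d}" "g ` fv \<phi> \<subseteq> {..<length as}"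
  shows "sat S (\<lambda>x. as ! g x) \<phi> \<longleftrightarrow> sat T (\<lambda>x. bs ! g x) \<phi>"
  using assms
proof (induction \<phi> arbitrary: q as bs g)
  case (Eq x y)
  have "Eq (g x) (g y) \<in> atoms d (length as)" using Eq by (auto simp: atoms_def)
  from hintikka_eq_atoms[OF Eq(1-4) this] show ?case by simp
next
  case (Less x y)
  have "Less (g x) (g y) \<in> atoms d (length as)" using Less by (auto simp: atoms_def)
  from hintikka_eq_atoms[OF Less(1-4) this] show ?case by simp
next
  case (Color i x)
  have "Color i (g x) \<in> atoms d (length as)" using Color by (auto simp: atoms_def)
  from hintikka_eq_atoms[OF Color(1-4) this] show ?case by simp
next
  case (Neg \<phi>)
  show ?case using Neg.IH[OF Neg.prems(1-4), of g] Neg.prems by simp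
next
  case (And \<phi> \<psi>)
  show ?case
    using And.IH(1)[OF And.prems(1-4), of g] And.IH(2)[OF And.prems(1-4), of g] And.prems
    by (simp add: image_Un)
next
  case (Or \<phi> \<psi>)
  show ?case
    using Or.IH(1)[OF Or.prems(1-4), of g] Or.IH(2)[OF Or.prems(1-4), of g] Or.prems
    by (simp add: image_Un)
next
  case (Ex x \<phi>)
  then obtain q' where q: "q = Suc q'" "qrank \<phi> \<le> q'" by (cases q) auto
  have step: "sat S ((\<lambda>y. as ! g y)(x := a)) \<phi> \<longleftrightarrow> sat T ((\<lambda>y. bs ! g y)(x := b)) \<phi>"
    if "a \<in> carr S" "b \<in> carr T" "hintikka d q' S (as @ [a]) = hintikka d q' T (bs @ [b])" for a b
  proof -
    let ?g = "g(x := length as)"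
    have "sat S (\<lambda>y. (as @ [a]) ! ?g y) \<phi> \<longleftrightarrow> sat T (\<lambda>y. (bs @ [b]) ! ?g y) \<phi>"
      by (rule Ex.IH[OF that(3)]) (use that Ex.prems q in \<open>auto simp: image_subset_iff less_Suc_eq\<close>)
    moreover have "sat S (\<lambda>y. (as @ [a]) ! ?g y) \<phi> \<longleftrightarrow> sat S ((\<lambda>y. as ! g y)(x := a)) \<phi>"
      by (rule sat_cong) (use Ex.prems(7) in \<open>auto simp: nth_append image_subset_iff\<close>)
    moreover have "sat T (\<lambda>y. (bs @ [b]) ! ?g y) \<phi> \<longleftrightarrow> sat T ((\<lambda>y. bs ! g y)(x := b)) \<phi>"
      by (rule sat_cong) (use Ex.prems(2,7) in \<open>auto simp: nth_append image_subset_iff\<close>)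
    ultimately show ?thesis by simp
  qed
  note ext = hintikka_Suc_eqD[OF Ex.prems(1)[unfolded q]]
  have "\<exists>b\<in>carr T. hintikka d q' S (as @ [a]) = hintikka d q' T (bs @ [b])" if "a \<in> carr S" for a
    using ext that by blast
  moreover have "\<exists>a\<in>carr S. hintikka d q' S (as @ [a]) = hintikka d q' T (bs @ [b])"
    if "b \<in> carr T" for b
    using imageI[OF that, of "\<lambda>b. hintikka d q' T (bs @ [b])"] unfolding ext[symmetric] by force
  ultimately show ?case unfolding sat.simps using step by meson
next
  case (All x \<phi>)
  then obtain q' where q: "q = Suc q'" "qrank \<phi> \<le> q'" by (cases q) auto
  have step: "sat S ((\<lambda>y. as ! g y)(x := a)) \<phi> \<longleftrightarrow> sat T ((\<lambda>y. bs ! g y)(x := b)) \<phi>"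
    if "a \<in> carr S" "b \<in> carr T" "hintikka d q' S (as @ [a]) = hintikka d q' T (bs @ [b])" for a b
  proof -
    let ?g = "g(x := length as)"
    have "sat S (\<lambda>y. (as @ [a]) ! ?g y) \<phi> \<longleftrightarrow> sat T (\<lambda>y. (bs @ [b]) ! ?g y) \<phi>"
      by (rule All.IH[OF that(3)]) (use that All.prems q in \<open>auto simp: image_subset_iff less_Suc_eq\<close>)
    moreover have "sat S (\<lambda>y. (as @ [a]) ! ?g y) \<phi> \<longleftrightarrow> sat S ((\<lambda>y. as ! g y)(x := a)) \<phi>"
      by (rule sat_cong) (use All.prems(7) in \<open>auto simp: nth_append image_subset_iff\<close>)
    moreover have "sat T (\<lambda>y. (bs @ [b]) ! ?g y) \<phi> \<longleftrightarrow> sat T ((\<lambda>y. bs ! g y)(x := b)) \<phi>"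
      by (rule sat_cong) (use All.prems(2,7) in \<open>auto simp: nth_append image_subset_iff\<close>)
    ultimately show ?thesis by simp
  qed
  note ext = hintikka_Suc_eqD[OF All.prems(1)[unfolded q]]
  have "\<exists>b\<in>carr T. hintikka d q' S (as @ [a]) = hintikka d q' T (bs @ [b])" if "a \<in> carr S" for a
    using ext that by blast
  moreover have "\<exists>a\<in>carr S. hintikka d q' S (as @ [a]) = hintikka d q' T (bs @ [b])"
    if "b \<in> carr T" for b
    using imageI[OF that, of "\<lambda>b. hintikka d q' T (bs @ [b])"] unfolding ext[symmetric] by force
  ultimately show ?case unfolding sat.simps using step by meson
qed simp

theorem char_sentence_eq_iff:
  fixes S :: "'a colored" and T :: "'b colored"
  shows "char_sentence d q S = char_sentence d q T \<longleftrightarrow> equiv_q d q S T"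
proof
  assume eq: "char_sentence d q S = char_sentence d q T"
  show "equiv_q d q S T"
    unfolding equiv_q_def
  proof (intro allI impI, elim conjE)
    fix \<phi> assume \<phi>: "sentence d \<phi>" "qrank \<phi> \<le> q"
    have "sat S (\<lambda>x. [] ! id x) \<phi> \<longleftrightarrow> sat T (\<lambda>x. [] ! id x) \<phi>"
      by (rule sat_eq_if_hintikka_eq[of d q])
        (use \<phi> eq in \<open>auto simp: sentence_def char_sentence_def\<close>)
    then show "models S \<phi> \<longleftrightarrow> models T \<phi>" using models_iff_sat[OF \<phi>(1)] by metis
  qed
next
  assume "equiv_q d q S T"
  then have "models S (char_sentence d q S) \<longleftrightarrow> models T (char_sentence d q S)"
    using sentence_char_sentence[of d q S] unfolding equiv_q_def by blast
  moreover have "models S (char_sentence d q S)"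
    by (auto simp: models_def char_sentence_def intro: sat_hintikka)
  ultimately have "sat T undefined (hintikka d q S [])"
    by (simp add: models_def char_sentence_def)
  from hintikka_eq_if_sat[OF this, of "[]"] show "char_sentence d q S = char_sentence d q T"
    by (simp add: char_sentence_def)
qed


section \<open>The ordinals \<open>\<omega>\<^sup>k\<close>\<close>

text \<open>
  \<open>\<omega>\<^sup>k\<^sup>+\<^sup>1 = \<omega>\<^sup>k \<cdot> \<omega>\<close> is the order type of \<open>\<omega>\<close> consecutive copies of \<open>\<omega>\<^sup>k\<close>; the head of the list
  is the index of the copy.
\<close>

primrec omega_pow :: "nat \<Rightarrow> nat list rel" where
  "omega_pow 0 = {([], [])}"
| "omega_pow (Suc k) =
     {(m # xs, n # ys) |m n xs ys.
        (m < n \<and> xs \<in> Field (omega_pow k) \<and> ys \<in> Field (omega_pow k)) \<or>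
        (m = n \<and> (xs, ys) \<in> omega_pow k)}"

lemma omega_pow_conv:
  "omega_pow k = lexn less_than k \<union> Id_on {xs. length xs = k}
     \<and> Field (omega_pow k) = {xs. length xs = k}"
proof (induction k)
  case 0
  show ?case by (auto simp: Field_def)
next
  case (Suc k)
  then have F: "Field (omega_pow k) = {xs. length xs = k}"
    and R: "omega_pow k = lexn less_than k \<union> Id_on {xs. length xs = k}" by auto
  have len: "length xs = k \<and> length ys = k" if "(xs, ys) \<in> lexn less_than k" for xs ys
    using that by (rule lexn_length)
  have eq: "omega_pow (Suc k) = lexn less_than (Suc k) \<union> Id_on {xs. length xs = Suc k}"
    (is "_ = ?R")
  proof -
    have "(m # us, n # vs) \<in> lexn less_than (Suc k) \<longleftrightarrow>
        length us = k \<and> length vs = k \<and> (m < n \<or> m = n \<and> (us, vs) \<in> lexn less_than k)"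
      for m n us vs by (force simp: image_iff Bex_def split_paired_Ex)
    then have "(m # us, n # vs) \<in> omega_pow (Suc k) \<longleftrightarrow> (m # us, n # vs) \<in> ?R" for m n us vs
      unfolding omega_pow.simps F unfolding R by (auto simp del: lexn.simps simp: Id_on_iff dest: len)
    moreover have "us \<noteq> [] \<and> vs \<noteq> []" if "(us, vs) \<in> omega_pow (Suc k) \<union> ?R" for us vs
      using that by (auto simp: Id_on_iff)
    ultimately have "(us, vs) \<in> omega_pow (Suc k) \<longleftrightarrow> (us, vs) \<in> ?R" for us vs
      by (metis UnCI list.exhaust)
    then show ?thesis by (intro set_eqI) (simp only: split_paired_all)
  qed
  have "Field ?R = {xs. length xs = Suc k}"
  proof
    show "Field ?R \<subseteq> {xs. length xs = Suc k}"
      by (auto simp: Field_def Id_on_iff simp del: lexn.simps dest: lexn_length)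
    show "{xs. length xs = Suc k} \<subseteq> Field ?R"
    proof
      fix xs :: "nat list" assume "xs \<in> {xs. length xs = Suc k}"
      then have "(xs, xs) \<in> ?R" by (simp add: Id_on_iff)
      then show "xs \<in> Field ?R" by (rule FieldI1)
    qed
  qed
  with eq show ?case by simp
qed

lemma Well_order_omega_pow: "Well_order (omega_pow k)"
proof -
  let ?A = "{xs :: nat list. length xs = k}"
  have R: "omega_pow k = lexn less_than k \<union> Id_on ?A" and F: "Field (omega_pow k) = ?A"
    using omega_pow_conv[of k] by blast+
  have wf: "wf (lexn less_than k)" by (rule wf_lexn) simp
  have tr: "trans (lexn less_than k)" by (rule lexn_transI) simp
  have tot: "(xs, ys) \<in> lexn less_than k \<or> xs = ys \<or> (ys, xs) \<in> lexn less_than k"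
    if "length xs = k" "length ys = k" for xs ys :: "nat list"
  proof -
    have "total (lenlex less_than)" by (rule total_lenlex) simp
    then have "xs = ys \<or> (xs, ys) \<in> lenlex less_than \<or> (ys, xs) \<in> lenlex less_than"
      by (auto simp: total_on_def)
    with that have "xs = ys \<or> (\<exists>n. (xs, ys) \<in> lexn less_than n) \<or> (\<exists>n. (ys, xs) \<in> lexn less_than n)"
      unfolding lenlex_conv by (auto simp: lex_def)
    with that show ?thesis by (metis lexn_length)
  qed
  have irr: "(xs, xs) \<notin> lexn less_than k" for xs using wf by auto
  have "trans (omega_pow k)"
    using tr unfolding R trans_def by blast
  moreover have "antisym (omega_pow k)"
    using tr irr unfolding R trans_def antisym_def by blast
  moreover have "omega_pow k - Id \<subseteq> lexn less_than k" unfolding R by auto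
  then have "wf (omega_pow k - Id)" using wf wf_subset by blast
  moreover have "refl_on ?A (omega_pow k)" "total_on ?A (omega_pow k)"
    using tot unfolding R refl_on_def total_on_def by (auto dest: lexn_length)
  ultimately show ?thesis
    unfolding well_order_on_def linear_order_on_def partial_order_on_def preorder_on_def F
    using FieldI1[of _ _ "omega_pow k"] FieldI2[of _ _ "omega_pow k"] F by auto
qed

end

theory Submission
  imports Defs "HOL-Library.Ramsey" "HOL-Library.Countable_Set"
begin

text \<open>
  Put \<open>p = q - 1\<close>. Two colored ordinals are \<open>q\<close>-equivalent iff they have the same \<open>p\<close>-characters,
  so it suffices to find a subset \<open>J\<close> of \<open>A\<close> whose elements have in \<open>J\<close> the same character as in \<open>A\<close>,
  which contains an element of every character, and in which no element is a limit of elements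
  of its own character. With \<open>k\<close> characters such a \<open>J\<close> has order type at most \<open>\<omega>\<^sup>k\<close>: by induction
  an element at a nonzero position divisible by \<open>\<omega>\<^sup>i\<close> is a limit of at least \<open>i\<close> characters, all
  different from its own, hence position \<open>\<omega>\<^sup>k\<close> is not occupied.

  \<open>J\<close> is found by transfinite recursion. If \<open>y\<close> is a limit of elements of its own character, then
  by Ramsey's theorem there is a cofinal sequence \<open>w\<^sub>0 < w\<^sub>1 < \<dots>\<close> of such elements with all intervals
  \<open>[w\<^sub>m, w\<^sub>n)\<close> of one \<open>p\<close>-type, and this type is then also that of \<open>[w\<^sub>0, y)\<close>. So deleting
  \<open>[w\<^sub>1, y)\<close> does not change the \<open>p\<close>-type of what precedes \<open>y\<close>, while the right types of the
  remaining elements survive as \<open>w\<^sub>1\<close> and \<open>y\<close> have the same character. Types are preserved exactly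
  and not just in context, so infinitely many deletions may be carried out along an \<open>\<omega>\<close>-sequence;
  intervals of uncountable cofinality are first cut down to a reflecting initial segment.
\<close>

section \<open>Locality of Hintikka formulas\<close>

lemma image_eq_image_iff:
  "f ` A = g ` B \<longleftrightarrow> (\<forall>a\<in>A. \<exists>b\<in>B. f a = g b) \<and> (\<forall>b\<in>B. \<exists>a\<in>A. f a = g b)"
proof
  assume eq: "f ` A = g ` B"
  have "\<exists>b\<in>B. f a = g b" if "a \<in> A" for a using eq imageI[OF that, of f] by auto
  moreover have "\<exists>a\<in>A. f a = g b" if "b \<in> B" for b using eq imageI[OF that, of g] by force
  ultimately show "(\<forall>a\<in>A. \<exists>b\<in>B. f a = g b) \<and> (\<forall>b\<in>B. \<exists>a\<in>A. f a = g b)" by blast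
qed force

text \<open>The existential half of the formula is built from the same set of Hintikka formulas that
  the universal half lists, so this set alone decides equality. Equal lengths make both formulas
  bind the same variable.\<close>

lemma hintikka_Suc_iff:
  fixes S :: "'a colored" and T :: "'b colored"
  assumes "length as = length bs"
  shows "hintikka d (Suc n) S as = hintikka d (Suc n) T bs \<longleftrightarrow>
    (\<lambda>a. hintikka d n S (as @ [a])) ` carr S = (\<lambda>b. hintikka d n T (bs @ [b])) ` carr T"
    (is "_ \<longleftrightarrow> ?X = ?Y")
proof
  assume eq: "?X = ?Y"
  from arg_cong[OF this, of "image (Ex (length as))"]
  have "(\<lambda>a. Ex (length as) (hintikka d n S (as @ [a]))) ` carr S
      = (\<lambda>b. Ex (length as) (hintikka d n T (bs @ [b]))) ` carr T"
    by (simp add: image_image)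
  with eq assms show "hintikka d (Suc n) S as = hintikka d (Suc n) T bs" by simp
qed (rule hintikka_Suc_eqD)

lemma hintikka_SucI:
  fixes S :: "'a colored" and T :: "'b colored"
  assumes "length as = length bs"
    and "\<And>a. a \<in> carr S \<Longrightarrow> \<exists>b\<in>carr T. hintikka d n S (as @ [a]) = hintikka d n T (bs @ [b])"
    and "\<And>b. b \<in> carr T \<Longrightarrow> \<exists>a\<in>carr S. hintikka d n S (as @ [a]) = hintikka d n T (bs @ [b])"
  shows "hintikka d (Suc n) S as = hintikka d (Suc n) T bs"
  using assms(2,3) unfolding hintikka_Suc_iff[OF assms(1)] image_eq_image_iff by blast

lemma hintikka_SucE:
  fixes S :: "'a colored" and T :: "'b colored"
  assumes "hintikka d (Suc n) S as = hintikka d (Suc n) T bs"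
  shows "a \<in> carr S \<Longrightarrow> \<exists>b\<in>carr T. hintikka d n S (as @ [a]) = hintikka d n T (bs @ [b])"
    and "b \<in> carr T \<Longrightarrow> \<exists>a\<in>carr S. hintikka d n S (as @ [a]) = hintikka d n T (bs @ [b])"
  using hintikka_Suc_eqD[OF assms] unfolding image_eq_image_iff by blast+

text \<open>For tuples of equal length this is a partial isomorphism with respect to the colors
  below \<open>d\<close>.\<close>

definition agree :: "nat \<Rightarrow> 'a colored \<Rightarrow> 'a list \<Rightarrow> 'b colored \<Rightarrow> 'b list \<Rightarrow> bool" where
  "agree d S as T bs \<longleftrightarrow> (\<forall>x<length as. \<forall>y<length as.
     (as ! x = as ! y \<longleftrightarrow> bs ! x = bs ! y) \<and> (lt S (as ! x) (as ! y) \<longleftrightarrow> lt T (bs ! x) (bs ! y)) \<and>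
     (\<forall>i<d. as ! x \<in> colr S i \<longleftrightarrow> bs ! x \<in> colr T i))"

lemma agree_iff_sat:
  "agree d S as T bs \<longleftrightarrow> (\<forall>\<phi>\<in>atoms d (length as). sat S (nth as) \<phi> \<longleftrightarrow> sat T (nth bs) \<phi>)"
proof
  assume *: "\<forall>\<phi>\<in>atoms d (length as). sat S (nth as) \<phi> \<longleftrightarrow> sat T (nth bs) \<phi>"
  have "Eq x y \<in> atoms d n \<and> Less x y \<in> atoms d n" if "x < n" "y < n" for x y n
    using that by (auto simp: atoms_def)
  moreover have "Color i x \<in> atoms d n" if "x < n" "i < d" for i x n
    using that by (auto simp: atoms_def)
  ultimately show "agree d S as T bs" using * unfolding agree_def by fastforce
qed (auto simp: agree_def atoms_def)

lemma hintikka_agree: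
  fixes S :: "'a colored" and T :: "'b colored"
  assumes "hintikka d n S as = hintikka d n T bs" "length as = length bs"
    and "set as \<subseteq> carr S" "set bs \<subseteq> carr T"
  shows "agree d S as T bs"
  unfolding agree_iff_sat using hintikka_eq_atoms[OF assms] by blast

lemma hintikka_0_if_agree:
  fixes S :: "'a colored" and T :: "'b colored"
  assumes "agree d S as T bs" "length as = length bs"
  shows "hintikka d 0 S as = hintikka d 0 T bs"
proof -
  have "literals d S as = literals d T bs"
    using assms unfolding agree_iff_sat literals_def by auto
  then show ?thesis by simp
qed

text \<open>An answer that is good for one more round is good now. At the bottom, rank 1 already
  forces agreement on atoms, which is all that rank 0 records.\<close>

lemma hintikka_Suc_mono:
  fixes S :: "'a colored" and T :: "'b colored"
  assumes "hintikka d (Suc n) S as = hintikka d (Suc n) T bs" "length as = length bs"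
    and "set as \<subseteq> carr S" "set bs \<subseteq> carr T"
  shows "hintikka d n S as = hintikka d n T bs"
  using assms
proof (induction n arbitrary: as bs)
  case 0
  from hintikka_agree[OF 0] show ?case using 0(2) by (rule hintikka_0_if_agree)
next
  case (Suc n)
  have IH: "hintikka d n S (as @ [a]) = hintikka d n T (bs @ [b])"
    if "hintikka d (Suc n) S (as @ [a]) = hintikka d (Suc n) T (bs @ [b])" "a \<in> carr S" "b \<in> carr T"
    for a b
    by (rule Suc.IH) (use that Suc.prems in auto)
  show ?case
    using hintikka_SucE[OF Suc.prems(1)] IH by (intro hintikka_SucI) (use Suc.prems(2) in blast)+
qed

section \<open>Cutting a structure at a point and gluing it again\<close>

text \<open>The flag \<open>l\<close> selects the lower part, so that a single induction treats both
  parts.\<close>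

definition side :: "bool \<Rightarrow> 'a colored \<Rightarrow> 'a \<Rightarrow> 'a \<Rightarrow> bool" where
  "side l S a x \<longleftrightarrow> (if l then lt S x a else lt S a x)"

definition half :: "bool \<Rightarrow> 'a colored \<Rightarrow> 'a \<Rightarrow> 'a colored" where
  "half l S a = substr S {b \<in> carr S. side l S a b}"

lemma half_simps [simp]:
  "half True S a = below S a" "half False S a = above S a"
  by (simp_all add: half_def side_def below_def above_def)

lemma substr_simps [simp]:
  "carr (substr S X) = carr S \<inter> X"
  "lt (substr S X) a b \<longleftrightarrow> lt S a b \<and> a \<in> carr S \<inter> X \<and> b \<in> carr S \<inter> X"
  "colr (substr S X) i = colr S i \<inter> X"
  by (auto simp: substr_def lt_def)

lemma agree_half:
  fixes S :: "'a colored" and T :: "'b colored"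
  assumes "agree d S (a # as) T (b # bs)" "length as = length bs"
    and "set as \<subseteq> carr (half l S a)" "set bs \<subseteq> carr (half l T b)"
  shows "agree d (half l S a) as (half l T b) bs"
  unfolding agree_def
proof (intro allI impI)
  fix x y assume "x < length as" "y < length as"
  then show "(as ! x = as ! y \<longleftrightarrow> bs ! x = bs ! y) \<and>
      (lt (half l S a) (as ! x) (as ! y) \<longleftrightarrow> lt (half l T b) (bs ! x) (bs ! y)) \<and>
      (\<forall>i<d. as ! x \<in> colr (half l S a) i \<longleftrightarrow> bs ! x \<in> colr (half l T b) i)"
    using assms(1)[unfolded agree_def, rule_format, of "Suc x" "Suc y"]
      subsetD[OF assms(3) nth_mem[of x]] subsetD[OF assms(3) nth_mem[of y]]
      subsetD[OF assms(4) nth_mem[of x]] subsetD[OF assms(4) nth_mem[of y]] assms(2)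
    unfolding half_def by simp
qed

text \<open>The cut point stays in front of the tuple as a parameter. Agreement on atoms forces
  every answer to a move on one side of \<open>a\<close> to lie on the same side of
  \<open>b\<close>, so the strategy restricts to the halves.\<close>

lemma hintikka_half:
  fixes S :: "'a colored" and T :: "'b colored"
  assumes "hintikka d n S (a # as) = hintikka d n T (b # bs)" "length as = length bs"
    and "a \<in> carr S" "b \<in> carr T"
    and "set as \<subseteq> carr (half l S a)" "set bs \<subseteq> carr (half l T b)"
  shows "hintikka d n (half l S a) as = hintikka d n (half l T b) bs"
  using assms
proof (induction n arbitrary: as bs)
  case 0
  then have "set as \<subseteq> carr S" "set bs \<subseteq> carr T" by (auto simp: half_def)
  then have "agree d S (a # as) T (b # bs)"
    using hintikka_agree[OF 0(1)] 0 by auto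
  from agree_half[OF this] 0 show ?case by (blast intro: hintikka_0_if_agree)
next
  case (Suc n)
  have sub: "set as \<subseteq> carr S" "set bs \<subseteq> carr T" using Suc.prems by (auto simp: half_def)
  have step: "side l S a c \<longleftrightarrow> side l T b c'"
    if "hintikka d n S (a # as @ [c]) = hintikka d n T (b # bs @ [c'])" "c \<in> carr S" "c' \<in> carr T"
    for c c'
  proof -
    have "agree d S (a # as @ [c]) T (b # bs @ [c'])"
      using hintikka_agree[OF that(1)] Suc.prems sub that by auto
    from this[unfolded agree_def, rule_format, of 0 "Suc (length as)"]
      this[unfolded agree_def, rule_format, of "Suc (length as)" 0]
    show ?thesis using Suc.prems(2) by (auto simp: side_def nth_append)
  qed
  show ?case
  proof (rule hintikka_SucI)
    fix c assume "c \<in> carr (half l S a)"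
    then have c: "c \<in> carr S" "side l S a c" by (auto simp: half_def)
    from hintikka_SucE(1)[OF Suc.prems(1) c(1)] obtain c' where c': "c' \<in> carr T"
      "hintikka d n S (a # as @ [c]) = hintikka d n T (b # bs @ [c'])" by auto
    with step c have "side l T b c'" by blast
    with c c' have "c' \<in> carr (half l T b)" by (auto simp: half_def)
    moreover have "hintikka d n (half l S a) (as @ [c]) = hintikka d n (half l T b) (bs @ [c'])"
      by (rule Suc.IH) (use Suc.prems calculation c c' \<open>c \<in> carr (half l S a)\<close> in auto)
    ultimately show "\<exists>c'\<in>carr (half l T b).
        hintikka d n (half l S a) (as @ [c]) = hintikka d n (half l T b) (bs @ [c'])" by blast
  next
    fix c' assume "c' \<in> carr (half l T b)"
    then have c': "c' \<in> carr T" "side l T b c'" by (auto simp: half_def)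
    from hintikka_SucE(2)[OF Suc.prems(1) c'(1)] obtain c where c: "c \<in> carr S"
      "hintikka d n S (a # as @ [c]) = hintikka d n T (b # bs @ [c'])" by auto
    with step c' have "side l S a c" by blast
    with c c' have "c \<in> carr (half l S a)" by (auto simp: half_def)
    moreover have "hintikka d n (half l S a) (as @ [c]) = hintikka d n (half l T b) (bs @ [c'])"
      by (rule Suc.IH) (use Suc.prems calculation c c' \<open>c' \<in> carr (half l T b)\<close> in auto)
    ultimately show "\<exists>c\<in>carr (half l S a).
        hintikka d n (half l S a) (as @ [c]) = hintikka d n (half l T b) (bs @ [c'])" by blast
  qed (use Suc.prems in simp)
qed

text \<open>
  A tuple of \<open>S\<close> is a shuffle of a tuple below \<open>a\<close>, of \<open>a\<close> itself and of a tuple above \<open>a\<close>;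
  the list \<open>cs\<close> of tags below records the shuffle.
\<close>

definition pick :: "'a \<Rightarrow> 'a list \<Rightarrow> 'a list \<Rightarrow> (nat + nat) option \<Rightarrow> 'a" where
  "pick a us vs c = (case c of None \<Rightarrow> a | Some (Inl i) \<Rightarrow> us ! i | Some (Inr i) \<Rightarrow> vs ! i)"

definition tags :: "nat \<Rightarrow> nat \<Rightarrow> (nat + nat) option set" where
  "tags m n = insert None (Some ` (Inl ` {..<m} \<union> Inr ` {..<n}))"

lemma map_pick_snoc:
  assumes "set cs \<subseteq> tags (length us) (length vs)"
  shows "map (pick a us vs) cs @ [a] = map (pick a us vs) (cs @ [None])"
    and "map (pick a us vs) cs @ [c] = map (pick a (us @ [c]) vs) (cs @ [Some (Inl (length us))])"
    and "map (pick a us vs) cs @ [c] = map (pick a us (vs @ [c])) (cs @ [Some (Inr (length vs))])"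
  using assms by (auto simp: pick_def tags_def nth_append split: option.splits sum.splits)

lemma lt_linear:
  assumes "linear_order_on (carr S) (ordr S)"
  shows "\<not> lt S x x" and "lt S x y \<Longrightarrow> lt S y z \<Longrightarrow> lt S x z"
    and "x \<in> carr S \<Longrightarrow> y \<in> carr S \<Longrightarrow> lt S x y \<or> x = y \<or> lt S y x"
  using assms unfolding lt_def linear_order_on_def partial_order_on_def preorder_on_def
  by (auto simp: total_on_def dest: transD antisymD)

text \<open>Strategies on the two sides combine: a move is answered on its own side, and a side that
  it does not touch is lowered by one rank through \<open>hintikka_Suc_mono\<close>. The tuple is an
  arbitrary shuffle because moves may alternate between the sides.\<close>

lemma hintikka_join:
  fixes S :: "'a colored" and T :: "'b colored"
  assumes lin: "linear_order_on (carr S) (ordr S)" "linear_order_on (carr T) (ordr T)"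
    and ab: "a \<in> carr S" "b \<in> carr T" "\<And>i. i < d \<Longrightarrow> a \<in> colr S i \<longleftrightarrow> b \<in> colr T i"
    and "hintikka d n (below S a) us = hintikka d n (below T b) us'" "length us = length us'"
    and "hintikka d n (above S a) vs = hintikka d n (above T b) vs'" "length vs = length vs'"
    and "set us \<subseteq> carr (below S a)" "set us' \<subseteq> carr (below T b)"
    and "set vs \<subseteq> carr (above S a)" "set vs' \<subseteq> carr (above T b)"
    and "set cs \<subseteq> tags (length us) (length vs)"
  shows "hintikka d n S (map (pick a us vs) cs) = hintikka d n T (map (pick b us' vs') cs)"
  using assms(6-)
proof (induction n arbitrary: us us' vs vs' cs)
  case 0
  note l1 = lt_linear[OF lin(1)] and l2 = lt_linear[OF lin(2)]
  have us: "us ! i \<in> carr S \<and> lt S (us ! i) a \<and> us' ! i \<in> carr T \<and> lt T (us' ! i) b"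
    if "i < length us" for i
    using 0(2,5,6) nth_mem[of i us] nth_mem[of i us'] that
    by (simp add: below_def subset_iff del: nth_mem)
  have vs: "vs ! i \<in> carr S \<and> lt S a (vs ! i) \<and> vs' ! i \<in> carr T \<and> lt T b (vs' ! i)"
    if "i < length vs" for i
    using 0(4,7,8) nth_mem[of i vs] nth_mem[of i vs'] that
    by (simp add: above_def subset_iff del: nth_mem)
  have agu: "agree d (below S a) us (below T b) us'" using hintikka_agree[OF 0(1,2,5,6)] .
  have agv: "agree d (above S a) vs (above T b) vs'" using hintikka_agree[OF 0(3,4,7,8)] .
  have uu: "(us ! i = us ! j \<longleftrightarrow> us' ! i = us' ! j) \<and>
      (lt S (us ! i) (us ! j) \<longleftrightarrow> lt T (us' ! i) (us' ! j)) \<and>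
      (\<forall>k<d. us ! i \<in> colr S k \<longleftrightarrow> us' ! i \<in> colr T k)"
    if "i < length us" "j < length us" for i j
    using agu[unfolded agree_def, rule_format, OF that] us that by (auto simp: below_def)
  have vv: "(vs ! i = vs ! j \<longleftrightarrow> vs' ! i = vs' ! j) \<and>
      (lt S (vs ! i) (vs ! j) \<longleftrightarrow> lt T (vs' ! i) (vs' ! j)) \<and>
      (\<forall>k<d. vs ! i \<in> colr S k \<longleftrightarrow> vs' ! i \<in> colr T k)"
    if "i < length vs" "j < length vs" for i j
    using agv[unfolded agree_def, rule_format, OF that] vs that by (auto simp: above_def)
  have uv: "us ! i \<noteq> vs ! j \<and> lt S (us ! i) (vs ! j) \<and> \<not> lt S (vs ! j) (us ! i) \<and>
      us' ! i \<noteq> vs' ! j \<and> lt T (us' ! i) (vs' ! j) \<and> \<not> lt T (vs' ! j) (us' ! i)"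
    if "i < length us" "j < length vs" for i j
    using us[OF that(1)] vs[OF that(2)] l1(1,2) l2(1,2) by metis
  have ua: "us ! i \<noteq> a \<and> lt S (us ! i) a \<and> \<not> lt S a (us ! i) \<and>
      us' ! i \<noteq> b \<and> lt T (us' ! i) b \<and> \<not> lt T b (us' ! i)" if "i < length us" for i
    using us[OF that] l1(1,2) l2(1,2) by metis
  have va: "vs ! i \<noteq> a \<and> lt S a (vs ! i) \<and> \<not> lt S (vs ! i) a \<and>
      vs' ! i \<noteq> b \<and> lt T b (vs' ! i) \<and> \<not> lt T (vs' ! i) b" if "i < length vs" for i
    using vs[OF that] l1(1,2) l2(1,2) by metis
  have ne: "i < length us \<Longrightarrow> a \<noteq> us ! i \<and> b \<noteq> us' ! i" "i < length vs \<Longrightarrow> a \<noteq> vs ! i \<and> b \<noteq> vs' ! i"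
    "i < length vs \<Longrightarrow> j < length us \<Longrightarrow> vs ! i \<noteq> us ! j \<and> vs' ! i \<noteq> us' ! j" for i j
    using ua[of i] va[of i] uv[of j i] by (blast, blast, fastforce)
  \<comment> \<open>Of the nine combinations of tags, two entries of one side are compared by
    agreement on that side, all other pairs by their position relative to the cut point.\<close>
  have pick: "(pick a us vs c = pick a us vs c' \<longleftrightarrow> pick b us' vs' c = pick b us' vs' c') \<and>
      (lt S (pick a us vs c) (pick a us vs c') \<longleftrightarrow> lt T (pick b us' vs' c) (pick b us' vs' c')) \<and>
      (\<forall>i<d. pick a us vs c \<in> colr S i \<longleftrightarrow> pick b us' vs' c \<in> colr T i)"
    if "c \<in> tags (length us) (length vs)" "c' \<in> tags (length us) (length vs)" for c c'
    using that unfolding tags_def pick_def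
    by (elim insertE imageE UnE)
      (simp_all add: uu vv uv ua va ne l1(1) l2(1) ab(3))
  have "agree d S (map (pick a us vs) cs) T (map (pick b us' vs') cs)"
    unfolding agree_def length_map
  proof (intro allI impI, goal_cases)
    case (1 x y)
    then have "cs ! x \<in> tags (length us) (length vs)" "cs ! y \<in> tags (length us) (length vs)"
      using 0(9) by auto
    then show ?case unfolding nth_map[OF 1(1)] nth_map[OF 1(2)] by (rule pick)
  qed
  then show ?case by (rule hintikka_0_if_agree) simp
next
  case (Suc n)
  have len: "length us' = length us" "length vs' = length vs" using Suc.prems by auto
  note cs = Suc.prems(9) Suc.prems(9)[folded len]
  have step: "hintikka d n S (map (pick a us vs) cs @ [c]) = hintikka d n T (map (pick b us' vs') cs @ [c'])"
    if c: "c \<in> carr S" "c' \<in> carr T" "c = a \<and> c' = b \<or>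
      lt S c a \<and> lt T c' b \<and> hintikka d n (below S a) (us @ [c]) = hintikka d n (below T b) (us' @ [c']) \<or>
      lt S a c \<and> lt T b c' \<and> hintikka d n (above S a) (vs @ [c]) = hintikka d n (above T b) (vs' @ [c'])"
    for c c'
  proof -
    have u: "hintikka d n (below S a) us = hintikka d n (below T b) us'"
      using Suc.prems(1,2,5,6) by (rule hintikka_Suc_mono)
    have v: "hintikka d n (above S a) vs = hintikka d n (above T b) vs'"
      using Suc.prems(3,4,7,8) by (rule hintikka_Suc_mono)
    from c(3) show ?thesis
    proof (elim disjE conjE)
      assume eq: "c = a" "c' = b"
      show ?thesis
        unfolding eq map_pick_snoc(1)[OF cs(1)] map_pick_snoc(1)[OF cs(2)]
        using cs by (intro Suc.IH[OF u Suc.prems(2) v Suc.prems(4-8)]) (simp_all add: tags_def)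
    next
      assume *: "lt S c a" "lt T c' b"
        "hintikka d n (below S a) (us @ [c]) = hintikka d n (below T b) (us' @ [c'])"
      show ?thesis
        unfolding map_pick_snoc(2)[OF cs(1)] map_pick_snoc(2)[OF cs(2)] len
        by (rule Suc.IH[OF *(3) _ v Suc.prems(4) _ _ Suc.prems(7,8)])
          (use cs len Suc.prems(5,6) c(1,2) *(1,2) in \<open>auto simp: tags_def below_def\<close>)
    next
      assume *: "lt S a c" "lt T b c'"
        "hintikka d n (above S a) (vs @ [c]) = hintikka d n (above T b) (vs' @ [c'])"
      show ?thesis
        unfolding map_pick_snoc(3)[OF cs(1)] map_pick_snoc(3)[OF cs(2)] len
        by (rule Suc.IH[OF u Suc.prems(2) *(3) _ Suc.prems(5,6)])
          (use cs len Suc.prems(7,8) c(1,2) *(1,2) in \<open>auto simp: tags_def above_def\<close>)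
    qed
  qed
  show ?case
  proof (rule hintikka_SucI)
    fix c assume c: "c \<in> carr S"
    consider "c = a" | "c \<in> carr (below S a)" | "c \<in> carr (above S a)"
      using lt_linear(3)[OF lin(1) c ab(1)] c by (auto simp: below_def above_def)
    then show "\<exists>c'\<in>carr T. hintikka d n S (map (pick a us vs) cs @ [c]) =
        hintikka d n T (map (pick b us' vs') cs @ [c'])"
    proof cases
      case 1 then show ?thesis using step[OF c ab(2)] ab by blast
    next
      case 2
      from hintikka_SucE(1)[OF Suc.prems(1) this] obtain c' where "c' \<in> carr (below T b)"
        "hintikka d n (below S a) (us @ [c]) = hintikka d n (below T b) (us' @ [c'])" by blast
      then show ?thesis using step[OF c, of c'] 2 by (auto simp: below_def)
    next
      case 3
      from hintikka_SucE(1)[OF Suc.prems(3) this] obtain c' where "c' \<in> carr (above T b)"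
        "hintikka d n (above S a) (vs @ [c]) = hintikka d n (above T b) (vs' @ [c'])" by blast
      then show ?thesis using step[OF c, of c'] 3 by (auto simp: above_def)
    qed
  next
    fix c' assume c: "c' \<in> carr T"
    consider "c' = b" | "c' \<in> carr (below T b)" | "c' \<in> carr (above T b)"
      using lt_linear(3)[OF lin(2) c ab(2)] c by (auto simp: below_def above_def)
    then show "\<exists>c\<in>carr S. hintikka d n S (map (pick a us vs) cs @ [c]) =
        hintikka d n T (map (pick b us' vs') cs @ [c'])"
    proof cases
      case 1 then show ?thesis using step[OF ab(1) c] ab by blast
    next
      case 2
      from hintikka_SucE(2)[OF Suc.prems(1) this] obtain c where "c \<in> carr (below S a)"
        "hintikka d n (below S a) (us @ [c]) = hintikka d n (below T b) (us' @ [c'])" by blast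
      then show ?thesis using step[OF _ c, of c] 2 by (auto simp: below_def)
    next
      case 3
      from hintikka_SucE(2)[OF Suc.prems(3) this] obtain c where "c \<in> carr (above S a)"
        "hintikka d n (above S a) (vs @ [c]) = hintikka d n (above T b) (vs' @ [c'])" by blast
      then show ?thesis using step[OF _ c, of c] 3 by (auto simp: above_def)
    qed
  qed simp
qed

section \<open>Characters and types of the next rank\<close>

lemma color_of_eqI: "colored_ordinal d S \<Longrightarrow> i < d \<Longrightarrow> a \<in> colr S i \<Longrightarrow> color_of d S a = i"
  unfolding color_of_def colored_ordinal_def
  by (rule the_equality) (auto simp: disjoint_family_on_def)

lemma color_of: "colored_ordinal d S \<Longrightarrow> a \<in> carr S \<Longrightarrow> color_of d S a < d \<and> a \<in> colr S (color_of d S a)"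
  using color_of_eqI[of d S _ a] unfolding colored_ordinal_def by blast

lemma color_of_eq_iff:
  fixes S :: "'a colored" and T :: "'b colored"
  assumes "colored_ordinal d S" "colored_ordinal d T" "a \<in> carr S" "b \<in> carr T"
  shows "color_of d S a = color_of d T b \<longleftrightarrow> (\<forall>i<d. a \<in> colr S i \<longleftrightarrow> b \<in> colr T i)"
  using color_of[OF assms(1,3)] color_of[OF assms(2,4)] color_of_eqI[OF assms(1), of _ a]
    color_of_eqI[OF assms(2), of _ b] by metis

text \<open>The rank \<open>n\<close> Hintikka formula of a single point carries the same
  information as its \<open>n\<close>-character: gluing gives one direction, restriction to the
  halves the other. What remains is one round of the game.\<close>

lemma char_sentence_Suc_iff:
  fixes S :: "'a colored" and T :: "'b colored"
  assumes S: "colored_ordinal d S" and T: "colored_ordinal d T"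
  shows "char_sentence d (Suc n) S = char_sentence d (Suc n) T \<longleftrightarrow>
    characters d n S = characters d n T"
proof -
  have lin: "linear_order_on (carr S) (ordr S)" "linear_order_on (carr T) (ordr T)"
    using S T by (auto simp: colored_ordinal_def well_order_on_def)
  have "character d n S a = character d n T b \<longleftrightarrow> hintikka d n S [a] = hintikka d n T [b]"
    if ab: "a \<in> carr S" "b \<in> carr T" for a b
  proof
    assume "character d n S a = character d n T b"
    then have *: "color_of d S a = color_of d T b"
      "hintikka d n (below S a) [] = hintikka d n (below T b) []"
      "hintikka d n (above S a) [] = hintikka d n (above T b) []"
      by (auto simp: character_def char_sentence_def)
    have "hintikka d n S (map (pick a [] []) [None]) = hintikka d n T (map (pick b [] []) [None])"
      by (rule hintikka_join[OF lin])
        (use ab * color_of_eq_iff[OF S T ab] in \<open>auto simp: tags_def\<close>)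
    then show "hintikka d n S [a] = hintikka d n T [b]" by (simp add: pick_def)
  next
    assume eq: "hintikka d n S [a] = hintikka d n T [b]"
    from hintikka_agree[OF this] ab have "\<forall>i<d. a \<in> colr S i \<longleftrightarrow> b \<in> colr T i"
      by (auto simp: agree_def)
    then have "color_of d S a = color_of d T b" using color_of_eq_iff[OF S T ab] by blast
    with hintikka_half[OF eq _ ab, of True] hintikka_half[OF eq _ ab, of False]
    show "character d n S a = character d n T b"
      by (simp add: character_def char_sentence_def)
  qed
  then show ?thesis
    unfolding char_sentence_def characters_def
    by (simp add: hintikka_Suc_iff image_eq_image_iff del: hintikka.simps)
qed

lemma hintikka_isomorphic:
  fixes S :: "'a colored" and T :: "'b colored"
  assumes f: "bij_betw f (carr S) (carr T)"
    and lt: "\<And>x y. x \<in> carr S \<Longrightarrow> y \<in> carr S \<Longrightarrow> lt T (f x) (f y) \<longleftrightarrow> lt S x y"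
    and col: "\<And>i x. i < d \<Longrightarrow> x \<in> carr S \<Longrightarrow> f x \<in> colr T i \<longleftrightarrow> x \<in> colr S i"
    and "set as \<subseteq> carr S"
  shows "hintikka d n S as = hintikka d n T (map f as)"
  using assms(4)
proof (induction n arbitrary: as)
  case 0
  have "f x = f y \<longleftrightarrow> x = y" if "x \<in> carr S" "y \<in> carr S" for x y
    using f that by (auto simp: bij_betw_def inj_on_def)
  with 0 lt col have "agree d S as T (map f as)" by (auto simp: agree_def subset_iff)
  then show ?case by (rule hintikka_0_if_agree) simp
next
  case (Suc n)
  have "hintikka d n S (as @ [a]) = hintikka d n T (map f as @ [f a])" if "a \<in> carr S" for a
    using Suc.IH[of "as @ [a]"] Suc.prems that by simp
  moreover have "carr T = f ` carr S" using f by (simp add: bij_betw_def)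
  ultimately show ?case
    by (intro hintikka_SucI) (auto simp del: hintikka.simps)
qed

section \<open>Types in a well-ordered chain\<close>

text \<open>\<open>ty n X\<close> stands for the rank \<open>n\<close> type of the substructure on
  \<open>X\<close>. The ranks are linked by \<open>ty_Suc\<close>, so all later arguments are of
  back-and-forth kind. Finiteness of types and colors feeds Ramsey's theorem and the reflection
  argument.\<close>

locale typed_chain =
  fixes C :: "'a set" and less :: "'a \<Rightarrow> 'a \<Rightarrow> bool" (infix "\<sqsubset>" 50)
    and col :: "'a \<Rightarrow> 'c" and ty :: "nat \<Rightarrow> 'a set \<Rightarrow> 't"
  assumes irrefl: "\<not> a \<sqsubset> a"
    and trans: "a \<sqsubset> b \<Longrightarrow> b \<sqsubset> c \<Longrightarrow> a \<sqsubset> c"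
    and total: "a \<in> C \<Longrightarrow> b \<in> C \<Longrightarrow> a \<sqsubset> b \<or> a = b \<or> b \<sqsubset> a"
    and least: "X \<subseteq> C \<Longrightarrow> X \<noteq> {} \<Longrightarrow> \<exists>m\<in>X. \<forall>x\<in>X. \<not> x \<sqsubset> m"
    and ty_0: "X \<subseteq> C \<Longrightarrow> Y \<subseteq> C \<Longrightarrow> ty 0 X = ty 0 Y"
    and ty_Suc: "X \<subseteq> C \<Longrightarrow> Y \<subseteq> C \<Longrightarrow> ty (Suc n) X = ty (Suc n) Y \<longleftrightarrow>
      (\<forall>a\<in>X. \<exists>b\<in>Y. col a = col b \<and> ty n {x \<in> X. x \<sqsubset> a} = ty n {y \<in> Y. y \<sqsubset> b} \<and>
        ty n {x \<in> X. a \<sqsubset> x} = ty n {y \<in> Y. b \<sqsubset> y}) \<and>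
      (\<forall>b\<in>Y. \<exists>a\<in>X. col a = col b \<and> ty n {x \<in> X. x \<sqsubset> a} = ty n {y \<in> Y. y \<sqsubset> b} \<and>
        ty n {x \<in> X. a \<sqsubset> x} = ty n {y \<in> Y. b \<sqsubset> y})"
    and finite_ty: "finite (ty n ` Pow C)"
    and finite_col: "finite (col ` C)"
begin

definition bel :: "'a set \<Rightarrow> 'a \<Rightarrow> 'a set" where "bel X a = {x \<in> X. x \<sqsubset> a}"

definition abv :: "'a set \<Rightarrow> 'a \<Rightarrow> 'a set" where "abv X a = {x \<in> X. a \<sqsubset> x}"

definition sep :: "'a set \<Rightarrow> 'a set \<Rightarrow> bool" (infix "\<lless>" 50) where
  "X \<lless> Y \<longleftrightarrow> (\<forall>x\<in>X. \<forall>y\<in>Y. x \<sqsubset> y)"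

lemma asym: "a \<sqsubset> b \<Longrightarrow> \<not> b \<sqsubset> a"
  using trans irrefl by blast

lemma sub [simp]: "X \<subseteq> C \<Longrightarrow> bel X a \<subseteq> C" "X \<subseteq> C \<Longrightarrow> abv X a \<subseteq> C"
  by (auto simp: bel_def abv_def)

lemma mem_bel [simp]: "x \<in> bel X a \<longleftrightarrow> x \<in> X \<and> x \<sqsubset> a"
  by (simp add: bel_def)

lemma mem_abv [simp]: "x \<in> abv X a \<longleftrightarrow> x \<in> X \<and> a \<sqsubset> x"
  by (simp add: abv_def)

lemma ty_SucI:
  assumes "X \<subseteq> C" "Y \<subseteq> C"
    and "\<And>a. a \<in> X \<Longrightarrow> \<exists>b\<in>Y. col a = col b \<and> ty n (bel X a) = ty n (bel Y b) \<and> ty n (abv X a) = ty n (abv Y b)"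
    and "\<And>b. b \<in> Y \<Longrightarrow> \<exists>a\<in>X. col a = col b \<and> ty n (bel X a) = ty n (bel Y b) \<and> ty n (abv X a) = ty n (abv Y b)"
  shows "ty (Suc n) X = ty (Suc n) Y"
  using assms unfolding ty_Suc[OF assms(1,2)] bel_def abv_def by blast

lemma ty_SucE:
  assumes "ty (Suc n) X = ty (Suc n) Y" "X \<subseteq> C" "Y \<subseteq> C" "a \<in> X"
  obtains b where "b \<in> Y" "col a = col b" "ty n (bel X a) = ty n (bel Y b)" "ty n (abv X a) = ty n (abv Y b)"
  using assms unfolding ty_Suc[OF assms(2,3)] bel_def abv_def by blast

lemma ty_Suc_mono: "ty (Suc n) X = ty (Suc n) Y \<Longrightarrow> X \<subseteq> C \<Longrightarrow> Y \<subseteq> C \<Longrightarrow> ty n X = ty n Y"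
proof (induction n arbitrary: X Y)
  case (Suc n)
  have IH: "ty n (bel X a) = ty n (bel Y b) \<and> ty n (abv X a) = ty n (abv Y b)"
    if "ty (Suc n) (bel X a) = ty (Suc n) (bel Y b)" "ty (Suc n) (abv X a) = ty (Suc n) (abv Y b)" for a b
    by (intro conjI Suc.IH that sub Suc.prems)
  show ?case
  proof (rule ty_SucI)
    fix a assume "a \<in> X"
    from ty_SucE[OF Suc.prems this] IH
    show "\<exists>b\<in>Y. col a = col b \<and> ty n (bel X a) = ty n (bel Y b) \<and> ty n (abv X a) = ty n (abv Y b)"
      by blast
  next
    fix b assume "b \<in> Y"
    from ty_SucE[OF Suc.prems(1)[symmetric] Suc.prems(3,2) this] obtain a where "a \<in> X" "col b = col a"
      "ty (Suc n) (bel Y b) = ty (Suc n) (bel X a)" "ty (Suc n) (abv Y b) = ty (Suc n) (abv X a)" .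
    with IH[of a b] show "\<exists>a\<in>X. col a = col b \<and> ty n (bel X a) = ty n (bel Y b) \<and> ty n (abv X a) = ty n (abv Y b)"
      by auto
  qed (use Suc.prems in auto)
qed (rule ty_0)

lemma ty_mono:
  assumes "ty n X = ty n Y" "m \<le> n" "X \<subseteq> C" "Y \<subseteq> C"
  shows "ty m X = ty m Y"
  using assms(2,1)
proof (induction rule: inc_induct)
  case (step k) then show ?case using ty_Suc_mono assms(3,4) by blast
qed

section \<open>Types of ordered sums\<close>

text \<open>
  The summands of an ordered sum are given as the fibres of a monotone map to the index order.
\<close>

lemma ty_blocks:
  fixes f g :: "'a \<Rightarrow> 'i :: linorder"
  assumes "X \<subseteq> C" "Y \<subseteq> C"
    and "monotone_on X (\<sqsubset>) (\<le>) f" "monotone_on Y (\<sqsubset>) (\<le>) g"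
    and "\<And>i. ty n {x \<in> X. f x = i} = ty n {y \<in> Y. g y = i}"
  shows "ty n X = ty n Y"
  using assms
proof (induction n arbitrary: X Y f g)
  case 0 then show ?case by (intro ty_0)
next
  case (Suc n)
  have half: "\<exists>b\<in>Y. col a = col b \<and> ty n (bel X a) = ty n (bel Y b) \<and> ty n (abv X a) = ty n (abv Y b)"
    if X: "X \<subseteq> C" and Y: "Y \<subseteq> C" and f: "monotone_on X (\<sqsubset>) (\<le>) f" and g: "monotone_on Y (\<sqsubset>) (\<le>) g"
      and eq: "\<And>i. ty (Suc n) {x \<in> X. f x = i} = ty (Suc n) {y \<in> Y. g y = i}" and a: "a \<in> X"
    for X Y and f g :: "'a \<Rightarrow> 'i" and a
  proof -
    let ?X = "\<lambda>i. {x \<in> X. f x = i}" and ?Y = "\<lambda>i. {y \<in> Y. g y = i}"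
    have "a \<in> ?X (f a)" using a by simp
    from ty_SucE[OF eq _ _ this] X Y obtain b where b: "b \<in> Y" "g b = f a" "col a = col b"
      and be: "ty n (bel (?X (f a)) a) = ty n (bel (?Y (f a)) b)"
      and ab: "ty n (abv (?X (f a)) a) = ty n (abv (?Y (f a)) b)"
      by blast
    have eq': "ty n (?X i) = ty n (?Y i)" for i
      by (rule ty_Suc_mono[OF eq]) (use X Y in auto)
    \<comment> \<open>Below \<open>c\<close> the earlier fibres remain whole, the fibre of
      \<open>c\<close> is cut and later fibres become empty, and dually above \<open>c\<close>.
      Hence both structures are again matched fibre by fibre at the lower rank.\<close>
    have part: "{x \<in> bel Z c. h x = i} = (if i < h c then {x \<in> Z. h x = i}
          else if i = h c then bel {x \<in> Z. h x = h c} c else {})"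
      "{x \<in> abv Z c. h x = i} = (if i > h c then {x \<in> Z. h x = i}
          else if i = h c then abv {x \<in> Z. h x = h c} c else {})"
      if "Z \<subseteq> C" "c \<in> Z" "monotone_on Z (\<sqsubset>) (\<le>) h"
      for Z c i and h :: "'a \<Rightarrow> 'i"
    proof -
      have *: "x \<sqsubset> c \<or> x = c \<or> c \<sqsubset> x" if "x \<in> Z" for x
        using total that \<open>Z \<subseteq> C\<close> \<open>c \<in> Z\<close> by blast
      have "x \<sqsubset> c \<Longrightarrow> h x < h c \<or> h x = h c" "c \<sqsubset> x \<Longrightarrow> h c < h x \<or> h x = h c" if "x \<in> Z" for x
        using \<open>c \<in> Z\<close> \<open>monotone_on Z (\<sqsubset>) (\<le>) h\<close> that unfolding monotone_on_def
        by (metis le_less)+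
      with * show "{x \<in> bel Z c. h x = i} = (if i < h c then {x \<in> Z. h x = i}
          else if i = h c then bel {x \<in> Z. h x = h c} c else {})"
        "{x \<in> abv Z c. h x = i} = (if i > h c then {x \<in> Z. h x = i}
          else if i = h c then abv {x \<in> Z. h x = h c} c else {})"
        by (simp_all add: bel_def abv_def set_eq_iff) (metis less_irrefl less_asym)+
    qed
    have "ty n (bel X a) = ty n (bel Y b)"
    proof (rule Suc.IH[where f = f and g = g])
      show "ty n {x \<in> bel X a. f x = i} = ty n {y \<in> bel Y b. g y = i}" for i
        unfolding part[OF X a f] part[OF Y b(1) g] b(2) using eq'[of i] be by simp
    qed (use X Y f g in \<open>auto simp: monotone_on_def\<close>)
    moreover have "ty n (abv X a) = ty n (abv Y b)"
    proof (rule Suc.IH[where f = f and g = g])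
      show "ty n {x \<in> abv X a. f x = i} = ty n {y \<in> abv Y b. g y = i}" for i
        unfolding part[OF X a f] part[OF Y b(1) g] b(2) using eq'[of i] ab by simp
    qed (use X Y f g in \<open>auto simp: monotone_on_def\<close>)
    ultimately show ?thesis using b by blast
  qed
  show ?case
  proof (rule ty_SucI)
    fix a assume "a \<in> X"
    then show "\<exists>b\<in>Y. col a = col b \<and> ty n (bel X a) = ty n (bel Y b) \<and> ty n (abv X a) = ty n (abv Y b)"
      by (rule half[OF Suc.prems])
  next
    fix b assume "b \<in> Y"
    from half[OF Suc.prems(2,1,4,3) Suc.prems(5)[symmetric] this]
    show "\<exists>a\<in>X. col a = col b \<and> ty n (bel X a) = ty n (bel Y b) \<and> ty n (abv X a) = ty n (abv Y b)"
      by metis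
  qed (use Suc.prems in auto)
qed

text \<open>A sum over the index order \<open>bool\<close>, where \<open>False\<close> precedes
  \<open>True\<close>; the index of a point is its membership in the second summand.\<close>

lemma ty_Un:
  assumes "X1 \<union> X2 \<subseteq> C" "Y1 \<union> Y2 \<subseteq> C" "X1 \<lless> X2" "Y1 \<lless> Y2"
    and "ty n X1 = ty n Y1" "ty n X2 = ty n Y2"
  shows "ty n (X1 \<union> X2) = ty n (Y1 \<union> Y2)"
proof (rule ty_blocks[where f = "\<lambda>x. x \<in> X2" and g = "\<lambda>y. y \<in> Y2"])
  have *: "{x \<in> U \<union> V. (x \<in> V) = i} = (if i then V else U)" if "U \<lless> V" for U V i
    using that irrefl by (auto simp: sep_def)
  show "ty n {x \<in> X1 \<union> X2. (x \<in> X2) = i} = ty n {y \<in> Y1 \<union> Y2. (y \<in> Y2) = i}" for i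
    unfolding *[OF assms(3)] *[OF assms(4)] using assms(5,6) by simp
  have mono: "monotone_on (U \<union> V) (\<sqsubset>) (\<le>) (\<lambda>x. x \<in> V)" if "U \<lless> V" for U V
  proof (rule monotone_onI)
    fix x x' assume "x \<in> U \<union> V" "x' \<in> U \<union> V" "x \<sqsubset> x'"
    then show "(x \<in> V) \<le> (x' \<in> V)" using that asym[of x x'] by (auto simp: sep_def)
  qed
  show "monotone_on (X1 \<union> X2) (\<sqsubset>) (\<le>) (\<lambda>x. x \<in> X2)" "monotone_on (Y1 \<union> Y2) (\<sqsubset>) (\<le>) (\<lambda>y. y \<in> Y2)"
    using mono assms(3,4) by blast+
qed (use assms in auto)

definition increasing :: "(nat \<Rightarrow> 'a set) \<Rightarrow> bool" where
  "increasing Z \<longleftrightarrow> (\<forall>i j. i < j \<longrightarrow> Z i \<lless> Z j)"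

text \<open>A sum over omega. Separated blocks are disjoint, so the first block containing a point
  is the only one. This is what permits infinitely many deletions at once.\<close>

lemma ty_UN:
  fixes X Y :: "nat \<Rightarrow> 'a set"
  assumes "\<And>i. X i \<subseteq> C" "\<And>i. Y i \<subseteq> C" "increasing X" "increasing Y"
    and "\<And>i. ty n (X i) = ty n (Y i)"
  shows "ty n (\<Union>i. X i) = ty n (\<Union>i. Y i)"
proof -
  define ix where "ix Z x = (LEAST i. x \<in> Z i)" for Z :: "nat \<Rightarrow> 'a set" and x
  have ix: "ix Z x = i" if "increasing Z" "x \<in> Z i" for Z x i
    unfolding ix_def
  proof (rule Least_equality)
    show "x \<in> Z i" by (rule that(2))
  next
    fix j assume "x \<in> Z j"
    then show "i \<le> j" using that irrefl unfolding increasing_def sep_def by (metis not_le)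
  qed
  have fib: "{x \<in> \<Union>i. Z i. ix Z x = i} = Z i" if "increasing Z" for Z i
    using ix[OF that] by blast
  have mono: "monotone_on (\<Union>i. Z i) (\<sqsubset>) (\<le>) (ix Z)" if Z: "increasing Z" for Z
  proof (rule monotone_onI)
    fix x x' assume x: "x \<in> (\<Union>i. Z i)" "x' \<in> (\<Union>i. Z i)" "x \<sqsubset> x'"
    then obtain i j where ij: "x \<in> Z i" "x' \<in> Z j" by blast
    then have "\<not> j < i" using Z asym[OF x(3)] by (auto simp: sep_def increasing_def)
    then show "ix Z x \<le> ix Z x'" using ix[OF Z ij(1)] ix[OF Z ij(2)] by simp
  qed
  show ?thesis
  proof (rule ty_blocks)
    show "ty n {x \<in> \<Union>i. X i. ix X x = i} = ty n {y \<in> \<Union>i. Y i. ix Y y = i}" for i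
      unfolding fib[OF assms(3)] fib[OF assms(4)] by (rule assms(5))
  qed (use assms(1,2) mono[OF assms(3)] mono[OF assms(4)] in auto)
qed

section \<open>Cofinal sequences and homogeneous intervals\<close>

lemma finite_bound:
  assumes "X \<subseteq> C" "W \<subseteq> X" "X \<noteq> {}" "\<forall>x\<in>X. \<exists>w\<in>W. x \<sqsubset> w" "finite F" "F \<subseteq> X"
  shows "\<exists>w\<in>W. \<forall>x\<in>F. x \<sqsubset> w"
  using assms(5,6)
proof (induction rule: finite_induct)
  case empty then show ?case using assms(3,4) by blast
next
  case (insert x F)
  then obtain w where w: "w \<in> W" "\<forall>y\<in>F. y \<sqsubset> w" by auto
  obtain w' where w': "w' \<in> W" "x \<sqsubset> w'" using assms(4) insert.prems by blast
  have "w \<sqsubset> w' \<or> w = w' \<or> w' \<sqsubset> w" using total w w' assms(1,2) by blast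
  then show ?case using w w' trans by blast
qed

text \<open>Each term exceeds its predecessor and the next member of an enumeration of
  \<open>X\<close>. Starting above \<open>F\<close> keeps a finite set of protected points out of
  later deletions.\<close>

lemma cofinal_sequence:
  assumes "X \<subseteq> C" "W \<subseteq> X" "X \<noteq> {}" "\<forall>x\<in>X. \<exists>w\<in>W. x \<sqsubset> w" "countable X"
    and "finite F" "F \<subseteq> X"
  obtains w :: "nat \<Rightarrow> 'a" where "\<And>n. w n \<in> W" "\<And>n. w n \<sqsubset> w (Suc n)"
    "\<And>x. x \<in> X \<Longrightarrow> \<exists>n. x \<sqsubset> w n" "\<And>x. x \<in> F \<Longrightarrow> x \<sqsubset> w 0"
proof -
  let ?e = "from_nat_into X"
  have e: "range ?e = X" using assms(3,5) by (simp add: range_from_nat_into)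
  have "\<exists>w. \<forall>n::nat. (w n \<in> W \<and> (n = 0 \<longrightarrow> (\<forall>x\<in>F. x \<sqsubset> w n))) \<and> (w n \<sqsubset> w (Suc n) \<and> ?e n \<sqsubset> w (Suc n))"
  proof (rule dependent_nat_choice)
    show "\<exists>x. x \<in> W \<and> (0 = (0::nat) \<longrightarrow> (\<forall>y\<in>F. y \<sqsubset> x))"
      using finite_bound[OF assms(1-4,6,7)] by blast
  next
    fix x and n :: nat assume "x \<in> W \<and> (n = 0 \<longrightarrow> (\<forall>y\<in>F. y \<sqsubset> x))"
    then have "{x, ?e n} \<subseteq> X" using e assms(2) by auto
    have "finite {x, ?e n}" by simp
    from finite_bound[OF assms(1-4) this \<open>{x, ?e n} \<subseteq> X\<close>] obtain y where
      "y \<in> W" "\<forall>z\<in>{x, ?e n}. z \<sqsubset> y" by (elim bexE)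
    then show "\<exists>y. (y \<in> W \<and> (Suc n = 0 \<longrightarrow> (\<forall>x\<in>F. x \<sqsubset> y))) \<and> x \<sqsubset> y \<and> ?e n \<sqsubset> y"
      by blast
  qed
  then obtain w :: "nat \<Rightarrow> 'a" where *: "\<forall>n. (w n \<in> W \<and> (n = 0 \<longrightarrow> (\<forall>x\<in>F. x \<sqsubset> w n))) \<and> (w n \<sqsubset> w (Suc n) \<and> ?e n \<sqsubset> w (Suc n))"
    by (elim exE)
  then have w: "\<And>n. w n \<in> W" "\<And>x. x \<in> F \<Longrightarrow> x \<sqsubset> w 0" "\<And>n. w n \<sqsubset> w (Suc n)"
    "\<And>n. ?e n \<sqsubset> w (Suc n)" by simp_all
  have "\<exists>n. x \<sqsubset> w n" if "x \<in> X" for x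
  proof -
    from that e obtain n where "x = ?e n" by (metis imageE)
    with w(4) show ?thesis by blast
  qed
  show thesis by (rule that[of w]) fact+
qed

lemma seq_less: "(\<And>n. w n \<sqsubset> w (Suc n)) \<Longrightarrow> m < n \<Longrightarrow> w m \<sqsubset> w n"
  by (induction n) (auto simp: less_Suc_eq intro: trans)

definition iv :: "'a set \<Rightarrow> 'a \<Rightarrow> 'a \<Rightarrow> 'a set" where
  "iv Z a b = {z \<in> Z. \<not> z \<sqsubset> a \<and> z \<sqsubset> b}"

text \<open>Ramsey's theorem for pairs, where a pair \<open>m < n\<close> is colored by the type of
  the interval that it spans.\<close>

lemma homogeneous_subsequence:
  assumes "Z \<subseteq> C"
  shows "\<exists>(r :: nat \<Rightarrow> nat) s. strict_mono r \<and> (\<forall>m n. m < n \<longrightarrow> ty p (iv Z (w (r m)) (w (r n))) = s)"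
proof -
  \<comment> \<open>The finitely many types are numbered, as \<open>Ramsey2\<close> takes its colors
    from an initial segment of the natural numbers.\<close>
  obtain h :: "'t \<Rightarrow> nat" and N where h: "inj_on h (ty p ` Pow C)" "h ` ty p ` Pow C = {i. i < N}"
    using finite_imp_inj_to_nat_seg[OF finite_ty[of p]] by metis
  \<comment> \<open>An unordered pair is read as an interval through its minimum and
    maximum.\<close>
  define g where "g A = h (ty p (iv Z (w (Min A)) (w (Max A))))" for A :: "nat set"
  have iv: "ty p (iv Z a b) \<in> ty p ` Pow C" for a b using assms by (auto simp: iv_def)
  have "\<forall>x\<in>UNIV. \<forall>y\<in>UNIV. x \<noteq> y \<longrightarrow> g {x, y} < N" using h(2) iv by (auto simp: g_def)
  from Ramsey2[OF _ this] obtain Y t where Y: "infinite Y" "\<forall>x\<in>Y. \<forall>y\<in>Y. x \<noteq> y \<longrightarrow> g {x, y} = t"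
    by auto
  let ?r = "enumerate Y"
  have r: "strict_mono ?r" using Y(1) by (rule strict_mono_enumerate)
  have "h (ty p (iv Z (w (?r m)) (w (?r n)))) = t" if "m < n" for m n
  proof -
    have "?r m < ?r n" using r that by (simp add: strict_mono_def)
    moreover have "g {?r m, ?r n} = t" using Y(2) enumerate_in_set[OF Y(1)] calculation by (metis less_irrefl)
    ultimately show ?thesis by (simp add: g_def)
  qed
  then have "ty p (iv Z (w (?r m)) (w (?r n))) = inv_into (ty p ` Pow C) h t" if "m < n" for m n
    using that iv h(1) by (metis inv_into_f_f)
  with r show ?thesis by blast
qed

text \<open>
  An idempotent type absorbs its own \<open>\<omega>\<close>-power as soon as it does so behind some prefix.
\<close>

lemma limit_absorb:
  assumes Z: "Z \<subseteq> C" and w: "\<And>n. w n \<in> Z" "\<And>n. w n \<sqsubset> w (Suc n)"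
    and cof: "\<And>z. z \<in> Z \<Longrightarrow> \<exists>n. z \<sqsubset> w n"
    and hom: "\<And>m n. m < n \<Longrightarrow> ty p (iv Z (w m) (w n)) = s"
    and pre: "\<And>n. ty p (bel Z (w n)) = ty p Z"
  shows "ty p {z \<in> Z. \<not> z \<sqsubset> w m} = s"
proof -
  define tl where "tl m = {z \<in> Z. \<not> z \<sqsubset> w m}" for m
  define I where "I m n = {z \<in> tl m. z \<sqsubset> w n}" for m n
  have I_iv: "I m n = iv Z (w m) (w n)" for m n by (auto simp: I_def tl_def iv_def)
  note less = seq_less[of w, OF w(2)]
  have subs: "tl m \<subseteq> C" "I m n \<subseteq> C" for m n using Z by (auto simp: tl_def I_def)
  have cmp: "x \<sqsubset> y \<or> x = y \<or> y \<sqsubset> x" if "x \<in> Z" "y \<in> Z" for x y using total that Z by blast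
  have tl_less: "z \<sqsubset> x" if "z \<sqsubset> w m" "x \<in> tl m" for z x m
    using cmp[OF w(1)[of m], of x] that trans by (auto simp: tl_def)
  have tl_tl: "tl n = {z \<in> tl m. \<not> z \<sqsubset> w n}" if "m < n" for m n
    using less[OF that] trans by (auto simp: tl_def)
  have tl_less': "z \<sqsubset> x" if "z \<sqsubset> w k" "\<not> x \<sqsubset> w k" "x \<in> tl m" for z x k m
    using tl_less[OF that(1)] that(2,3) by (auto simp: tl_def)
  have below: "x \<sqsubset> w n" if "x \<sqsubset> w m" "m < n" for x m n
    using less[OF that(2)] that(1) trans by blast
  have sepw: "A \<lless> B" if "\<And>x. x \<in> A \<Longrightarrow> x \<sqsubset> w k" "B \<subseteq> tl k" for A B k
    unfolding sep_def using that tl_less by blast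
  have I_tl: "I m n \<subseteq> tl m" and I_less: "x \<in> I m n \<Longrightarrow> x \<sqsubset> w n" for x m n by (auto simp: I_def)
  have homq: "ty q (I m n) = ty q (I m' n')" if "m < n" "m' < n'" "q \<le> p" for m n m' n' q
    using ty_mono[of p "I m n" "I m' n'" q] hom[of m n] hom[of m' n'] that subs by (simp add: I_iv)
  \<comment> \<open>Induction on the rank for all \<open>m\<close> at once, since the claim of lower
    rank is applied to later tails.\<close>
  have main: "ty q (tl m) = ty q (I m (Suc m))" if "q \<le> p" for q m
    using that
  proof (induction q arbitrary: m)
    case 0 show ?case by (intro ty_0 subs)
  next
    case (Suc q)
    have IH: "ty q (tl m) = ty q (I m' n')" if "m' < n'" for m m' n'
      by (rule HOL.trans[OF Suc.IH homq]) (use that Suc.prems in auto)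
    show ?case
    proof (rule ty_SucI)
      fix e assume e: "e \<in> tl m"
      then have "e \<in> Z" by (simp add: tl_def)
      from cof[OF this] obtain n0 where "e \<sqsubset> w n0" by blast
      \<comment> \<open>An index beyond both \<open>e\<close> and \<open>m\<close>. Up to
        \<open>w n\<close> the tail and \<open>I m (Suc n)\<close> coincide; what follows is
        exchanged for one more interval by the induction hypothesis.\<close>
      define n where "n = Suc (n0 + m)"
      have n: "m < n" "e \<sqsubset> w n" using below[OF \<open>e \<sqsubset> w n0\<close>, of n] by (auto simp: n_def)
      have en: "e \<sqsubset> w (Suc n)" using below[OF n(2)] by simp
      have abv1: "abv (tl m) e = abv (I m n) e \<union> tl n"
        unfolding abv_def I_def tl_tl[OF n(1)] using tl_less'[OF n(2)] by blast
      have abv2: "abv (I m (Suc n)) e = abv (I m n) e \<union> I n (Suc n)"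
        unfolding abv_def I_def tl_tl[OF n(1)]
        using tl_less'[OF n(2)] below[OF _ lessI, of _ n] by blast
      have "ty q (abv (tl m) e) = ty q (abv (I m (Suc n)) e)" unfolding abv1 abv2
      proof (rule ty_Un)
        show "abv (I m n) e \<lless> tl n" by (rule sepw[of _ n]) (auto simp: I_def)
        show "abv (I m n) e \<lless> I n (Suc n)" by (rule sepw[of _ n]) (auto simp: I_def)
        show "ty q (tl n) = ty q (I n (Suc n))" by (rule IH) simp
      qed (use subs in auto)
      moreover have "bel (tl m) e = bel (I m (Suc n)) e"
        unfolding bel_def I_def using en trans by blast
      moreover have "e \<in> I m (Suc n)" using e en by (simp add: I_def)
      have "ty (Suc q) (I m (Suc n)) = ty (Suc q) (I m (Suc m))"
        by (rule homq) (use n(1) Suc.prems in auto)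
      from ty_SucE[OF this subs(2) subs(2) \<open>e \<in> I m (Suc n)\<close>]
      obtain e' where "e' \<in> I m (Suc m)" "col e = col e'"
        "ty q (bel (I m (Suc n)) e) = ty q (bel (I m (Suc m)) e')"
        "ty q (abv (I m (Suc n)) e) = ty q (abv (I m (Suc m)) e')" .
      ultimately show "\<exists>e'\<in>I m (Suc m). col e = col e' \<and> ty q (bel (tl m) e) = ty q (bel (I m (Suc m)) e') \<and>
          ty q (abv (tl m) e) = ty q (abv (I m (Suc m)) e')" by auto
    next
      fix e assume e: "e \<in> I m (Suc m)"
      then have em: "e \<in> tl m" "e \<sqsubset> w (Suc m)" "e \<in> Z" by (auto simp: I_def tl_def)
      define U where "U = abv (I m (Suc m)) e"
      have "\<not> x \<sqsubset> w m" if "e \<sqsubset> x" for x using em(1) that trans by (auto simp: tl_def)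
      then have U: "U = abv (bel Z (w (Suc m))) e"
        unfolding U_def I_def tl_def bel_def abv_def by blast
      \<comment> \<open>Here the assumption on prefixes enters: \<open>e\<close>, seen in
        \<open>bel Z (w (Suc m))\<close>, is matched by some \<open>f\<close> in all of
        \<open>Z\<close>, so \<open>U\<close> has the type of a final segment of
        \<open>Z\<close>.\<close>
      have "ty (Suc q) (bel Z (w (Suc m))) = ty (Suc q) Z"
        by (rule ty_mono[OF pre]) (use Suc.prems Z in auto)
      from ty_SucE[OF this sub(1)[OF Z] Z, of e] em obtain f where f: "f \<in> Z" "ty q U = ty q (abv Z f)"
        unfolding U by (metis mem_bel)
      from cof[OF f(1)] obtain n where n: "f \<sqsubset> w n" by blast
      define V where "V = abv (bel Z (w n)) f"
      have V: "abv Z f = V \<union> tl n"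
        using tl_less[OF n] unfolding V_def abv_def bel_def tl_def by auto
      have Vn: "x \<sqsubset> w n" if "x \<in> V" for x using that by (simp add: V_def)
      have VC: "V \<subseteq> C" "U \<subseteq> C" using Z by (auto simp: V_def U)
      have U': "ty q U = ty q (V \<union> I n k)" if "n < k" for k
        unfolding f(2) V
      proof (rule ty_Un)
        show "V \<lless> tl n" "V \<lless> I n k" using sepw[OF Vn] I_tl by blast+
      qed (use subs VC IH[OF that] in auto)
      have "abv (tl m) e = U \<union> tl (Suc m)"
        unfolding U_def abv_def I_def tl_tl[OF lessI[of m]] using tl_less'[OF em(2)] by blast
      \<comment> \<open>\<open>U\<close> is exchanged for \<open>V\<close> followed by one interval,
        and the tail for the next interval. The two intervals merge into one, and \<open>V\<close>
        followed by one interval has again the type of \<open>U\<close>.\<close>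
      also have "ty q \<dots> = ty q ((V \<union> I n (Suc n)) \<union> I (Suc n) (Suc (Suc n)))"
      proof (rule ty_Un)
        show "U \<lless> tl (Suc m)" by (rule sepw[of _ "Suc m"]) (auto simp: U_def I_def)
        show "V \<union> I n (Suc n) \<lless> I (Suc n) (Suc (Suc n))"
          by (rule sepw[of _ "Suc n"]) (use below[OF Vn, of _ "Suc n"] I_less I_tl in auto)
        show "ty q U = ty q (V \<union> I n (Suc n))" by (rule U') simp
        show "ty q (tl (Suc m)) = ty q (I (Suc n) (Suc (Suc n)))" by (rule IH) simp
      qed (use subs VC in auto)
      also have "(V \<union> I n (Suc n)) \<union> I (Suc n) (Suc (Suc n)) = V \<union> I n (Suc (Suc n))"
        unfolding I_def tl_tl[OF lessI[of n]] using below[OF _ lessI, of _ "Suc n"] by blast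
      also have "ty q \<dots> = ty q U" using U'[of "Suc (Suc n)"] by simp
      finally have "ty q (abv (tl m) e) = ty q U" .
      moreover have "bel (tl m) e = bel (I m (Suc m)) e"
        unfolding bel_def I_def using em(2) trans by blast
      ultimately show "\<exists>a\<in>tl m. col a = col e \<and> ty q (bel (tl m) a) = ty q (bel (I m (Suc m)) e) \<and>
          ty q (abv (tl m) a) = ty q (abv (I m (Suc m)) e)" using U_def em(1) by auto
    qed (use subs in auto)
  qed
  from main[of p m] hom[of m "Suc m"] show ?thesis by (simp add: tl_def I_iv)
qed

section \<open>Thinning out\<close>

text \<open>Types are taken in the whole chain \<open>C\<close>, also for points of a subset under
  consideration.\<close>

definition chr :: "nat \<Rightarrow> 'a \<Rightarrow> 'c \<times> 't \<times> 't" where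
  "chr p a = (col a, ty p (bel C a), ty p (abv C a))"

text \<open>The condition \<open>bel J y \<noteq> {}\<close> excludes a first element, for which
  cofinality would be vacuous.\<close>

definition own_limit :: "nat \<Rightarrow> 'a set \<Rightarrow> 'a \<Rightarrow> bool" where
  "own_limit p J y \<longleftrightarrow> bel J y \<noteq> {} \<and> (\<forall>b\<in>bel J y. \<exists>x\<in>bel J y. b \<sqsubset> x \<and> chr p x = chr p y)"

lemma own_limit_cong: "bel J y = bel J' y \<Longrightarrow> own_limit p J y \<longleftrightarrow> own_limit p J' y"
  by (simp add: own_limit_def)

definition down_closed :: "'a set \<Rightarrow> bool" where
  "down_closed D \<longleftrightarrow> D \<subseteq> C \<and> (\<forall>x\<in>D. \<forall>y\<in>C. y \<sqsubset> x \<longrightarrow> y \<in> D)"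

text \<open>A proper initial segment is \<open>bel C u\<close> for the least point \<open>u\<close>
  left out, so strict inclusion of initial segments is well-founded. Segments of the form
  \<open>bel C v\<close> are settled first; the last step covers \<open>D\<close> itself, which may
  be all of \<open>C\<close>.\<close>

lemma down_closed_induct [consumes 1, case_names step]:
  assumes D: "down_closed D"
    and step: "\<And>D. down_closed D \<Longrightarrow> (\<And>D'. down_closed D' \<Longrightarrow> D' \<subset> D \<Longrightarrow> P D') \<Longrightarrow> P D"
  shows "P D"
proof -
  have bel: "P (bel C v)" if v: "v \<in> C" for v
  proof (rule ccontr)
    assume "\<not> P (bel C v)"
    with v have "{v \<in> C. \<not> P (bel C v)} \<noteq> {}" by blast
    from least[OF _ this] obtain m where m: "m \<in> C" "\<not> P (bel C m)"
      "\<forall>x\<in>{v \<in> C. \<not> P (bel C v)}. \<not> x \<sqsubset> m" by auto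
    have "P (bel C m)"
    proof (rule step)
      show "down_closed (bel C m)" using trans by (auto simp: down_closed_def)
      fix D' assume D': "down_closed D'" "D' \<subset> bel C m"
      then have "bel C m - D' \<noteq> {}" "bel C m - D' \<subseteq> C" by auto
      with least obtain u where u: "u \<in> bel C m - D'" "\<forall>x\<in>bel C m - D'. \<not> x \<sqsubset> u" by metis
      have "D' = bel C u"
      proof (intro set_eqI iffI)
        fix x assume x: "x \<in> D'"
        then have "x \<in> C" using D'(1) by (auto simp: down_closed_def)
        have "\<not> u \<sqsubset> x" "u \<noteq> x" using x u(1) D'(1) by (auto simp: down_closed_def)
        then show "x \<in> bel C u" using total[of x u] \<open>x \<in> C\<close> u(1) by auto
      next
        fix x assume x: "x \<in> bel C u"
        then have "x \<in> bel C m" using u(1) trans[of x u m] by auto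
        then show "x \<in> D'" using u(2) x by auto
      qed
      then show "P D'" using m(3) u(1) by auto
    qed
    with m(2) show False by blast
  qed
  show ?thesis
  proof (rule step[OF D])
    fix D' assume D': "down_closed D'" "D' \<subset> D"
    then have "D - D' \<noteq> {}" "D - D' \<subseteq> C" using D by (auto simp: down_closed_def)
    with least obtain u where u: "u \<in> D - D'" "\<forall>x\<in>D - D'. \<not> x \<sqsubset> u" by metis
    have uC: "u \<in> C" using u(1) D by (auto simp: down_closed_def)
    have "D' = bel C u"
    proof (intro set_eqI iffI)
      fix x assume x: "x \<in> D'"
      then have "x \<in> C" using D'(1) by (auto simp: down_closed_def)
      have "\<not> u \<sqsubset> x" "u \<noteq> x" using x u(1) uC D'(1) by (auto simp: down_closed_def)
      then show "x \<in> bel C u" using total[of x u] \<open>x \<in> C\<close> uC by auto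
    next
      fix x assume x: "x \<in> bel C u"
      then have "x \<in> D" using u(1) D by (auto simp: down_closed_def)
      then show "x \<in> D'" using u(2) x by auto
    qed
    then show "P D'" using bel[OF uC] by simp
  qed
qed

text \<open>
  Left types are kept inside \<open>M\<close> itself, whereas right types are kept only together with the
  part \<open>R\<close> that follows \<open>M\<close>.
\<close>

definition thinned :: "nat \<Rightarrow> 'a set \<Rightarrow> 'a set \<Rightarrow> 'a set \<Rightarrow> 'a set \<Rightarrow> bool" where
  "thinned p F M R M' \<longleftrightarrow> M' \<subseteq> M \<and> countable M' \<and> ty p M' = ty p M \<and> F \<inter> M \<subseteq> M' \<and>
     (\<forall>b\<in>M'. ty p (bel M' b) = ty p (bel M b)) \<and>
     (\<forall>b\<in>M'. ty p (abv M' b \<union> R) = ty p (abv C b)) \<and>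
     (\<forall>y\<in>M'. \<not> own_limit p M' y) \<and>
     (\<forall>y\<in>M. abv M y = {} \<longrightarrow> y \<in> M')"

text \<open>Asking for all intervals \<open>D - E\<close> lets one induction on \<open>D\<close>
  reach intervals with any beginning. \<open>R\<close> stands for what follows \<open>D\<close>:
  seen from any point of \<open>D\<close>, it completes the right type to the one in
  \<open>C\<close>.\<close>

definition thinnable :: "nat \<Rightarrow> 'a set \<Rightarrow> 'a set \<Rightarrow> bool" where
  "thinnable p F D \<longleftrightarrow> (\<forall>E R. down_closed E \<longrightarrow> E \<subseteq> D \<longrightarrow> R \<subseteq> C \<longrightarrow> D \<lless> R \<longrightarrow>
     (\<forall>b\<in>D. ty p (abv D b \<union> R) = ty p (abv C b)) \<longrightarrow> (\<exists>M'. thinned p F (D - E) R M'))"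

lemma thinnableD:
  assumes "thinnable p F D" "down_closed E" "E \<subseteq> D" "R \<subseteq> C" "D \<lless> R"
    and "\<And>b. b \<in> D \<Longrightarrow> ty p (abv D b \<union> R) = ty p (abv C b)"
  obtains M' where "thinned p F (D - E) R M'"
  using assms unfolding thinnable_def by blast

lemma ty_Un_left:
  assumes "X \<union> Z \<subseteq> C" "Y \<union> Z \<subseteq> C" "X \<lless> Z" "Y \<lless> Z" "ty n X = ty n Y"
  shows "ty n (X \<union> Z) = ty n (Y \<union> Z)"
  using ty_Un[OF assms(1-5) refl] .

lemma ty_Un_right:
  assumes "Z \<union> X \<subseteq> C" "Z \<union> Y \<subseteq> C" "Z \<lless> X" "Z \<lless> Y" "ty n X = ty n Y"
  shows "ty n (Z \<union> X) = ty n (Z \<union> Y)"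
  using ty_Un[OF assms(1-4) refl assms(5)] .

lemma ty_singleton: "a \<in> C \<Longrightarrow> b \<in> C \<Longrightarrow> col a = col b \<Longrightarrow> ty n {a} = ty n {b}"
proof (cases n)
  case (Suc m)
  assume "a \<in> C" "b \<in> C" "col a = col b"
  moreover have "bel {x} x = {}" "abv {x} x = {}" for x using irrefl by auto
  ultimately show ?thesis unfolding Suc by (intro ty_SucI) auto
qed (auto intro: ty_0)

lemma sep_mono: "X \<lless> Y \<Longrightarrow> X' \<subseteq> X \<Longrightarrow> Y' \<subseteq> Y \<Longrightarrow> X' \<lless> Y'"
  by (auto simp: sep_def)

section \<open>Intervals with a last element\<close>

text \<open>The part before the last element \<open>y\<close> is thinned to \<open>X\<close>, with
  \<open>y\<close> counted to what follows. If this makes \<open>y\<close> an own limit,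
  \<open>X\<close> is cut at a point of the same character as \<open>y\<close>; that point is no own
  limit, and \<open>y\<close> takes over its predecessors.\<close>

lemma thin_max_step:
  assumes D: "down_closed D" and E: "down_closed E" "E \<subseteq> D" and R: "R \<subseteq> C" "D \<lless> R"
    and ctx: "\<And>b. b \<in> D \<Longrightarrow> ty p (abv D b \<union> R) = ty p (abv C b)"
    and y: "y \<in> D - E" "abv D y = {}"
    and F: "finite F"
    and IH: "thinnable p F (bel C y)"
  shows "\<exists>M'. thinned p F (D - E) R M'"
proof -
  have yC: "y \<in> C" and DC: "D \<subseteq> C" using y D by (auto simp: down_closed_def)
  define D0 where "D0 = bel C y"
  define M where "M = D - E"
  define M0 where "M0 = D0 - E"
  have cmp: "a \<sqsubset> b \<or> a = b \<or> b \<sqsubset> a" if "a \<in> D" "b \<in> D" for a b using that total DC by blast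
  have D0: "D = insert y D0" "y \<notin> D0"
  proof -
    have "x \<sqsubset> y \<or> x = y" if "x \<in> D" for x using y that mem_abv cmp[of x y] by blast
    then show "D = insert y D0" "y \<notin> D0"
      using y(1) D irrefl unfolding D0_def down_closed_def bel_def by blast+
  qed
  have less_y: "x \<sqsubset> y" if "x \<in> D0" for x using that by (simp add: D0_def)
  have "E \<subseteq> D0"
  proof
    fix x assume x: "x \<in> E"
    then have "x \<noteq> y" "\<not> y \<sqsubset> x" using y E(1) yC by (auto simp: down_closed_def)
    then show "x \<in> D0" using x E(2) D0(1) by blast
  qed
  have yR: "y \<sqsubset> x" if "x \<in> R" for x using R(2) y(1) that by (auto simp: sep_def)
  have M: "M = insert y M0" "y \<notin> M0" "M0 \<subseteq> D0" "M0 \<subseteq> C"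
    using D0 y(1) DC by (auto simp: M_def M0_def)
  define R0 where "R0 = insert y R"
  have R0: "R0 \<subseteq> C" "D0 \<lless> R0"
    using R yC less_y D0(1) by (auto simp: R0_def sep_def)
  have abvD: "abv D b \<union> R = abv D0 b \<union> R0" if "b \<in> D0" for b
    using D0 less_y[OF that] by (auto simp: R0_def)
  have ctx0: "ty p (abv D0 b \<union> R0) = ty p (abv C b)" if "b \<in> D0" for b
    using ctx[of b] that D0(1) abvD[OF that] by simp
  obtain X where X: "thinned p F M0 R0 X"
    unfolding M0_def
    by (rule thinnableD[OF IH[folded D0_def] E(1) \<open>E \<subseteq> D0\<close> R0 ctx0])
  have X_sub: "X \<subseteq> M0" "X \<subseteq> C" and X_cnt: "countable X" and X_ty: "ty p X = ty p M0"
    and X_F: "F \<inter> M0 \<subseteq> X" and X_bel: "\<And>b. b \<in> X \<Longrightarrow> ty p (bel X b) = ty p (bel M0 b)"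
    and X_abv: "\<And>b. b \<in> X \<Longrightarrow> ty p (abv X b \<union> R0) = ty p (abv C b)"
    and X_lim: "\<And>b. b \<in> X \<Longrightarrow> \<not> own_limit p X b"
    using X M(4) by (auto simp: thinned_def)
  have X_y: "x \<sqsubset> y" if "x \<in> X" for x using that X_sub M less_y by auto
  have belM: "bel M b = bel M0 b" if "b \<in> M0" for b
    using asym[OF less_y[of b]] that M by auto
  have belM_y: "bel M y = M0" using M less_y irrefl by auto
  have ty_y: "ty p (abv C y) = ty p R"
    using ctx[of y] y by simp
  \<comment> \<open>Serves both outcomes, \<open>N = X\<close> and a truncated \<open>N\<close>: an
    initial segment of \<open>X\<close> with the type of \<open>X\<close>, the protected points and
    correct right types can be closed off by \<open>y\<close>, provided that \<open>y\<close> is no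
    own limit.\<close>
  have complete: "thinned p F M R (insert y N)"
    if N: "N \<subseteq> X" "\<And>b. b \<in> N \<Longrightarrow> bel X b \<subseteq> N" "ty p N = ty p X" "F \<inter> M0 \<subseteq> N"
      and N_abv: "\<And>b. b \<in> N \<Longrightarrow> ty p (abv N b \<union> R0) = ty p (abv C b)"
      and y_lim: "\<not> own_limit p (insert y N) y"
    for N
  proof -
    have bel: "bel (insert y N) b = bel X b" if "b \<in> N" for b
    proof -
      have "b \<in> X" using N(1) that by blast
      then have "\<not> y \<sqsubset> b" using X_y asym by blast
      then show ?thesis using N(1) N(2)[OF that] unfolding bel_def by blast
    qed
    have bel_y: "bel (insert y N) y = N" using N(1) X_y irrefl by auto
    have abv: "abv (insert y N) b \<union> R = abv N b \<union> R0" if "b \<in> N" for b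
      using X_y[OF subsetD[OF N(1) that]] by (auto simp: R0_def)
    have abv_y: "abv (insert y N) y = {}"
      using asym[OF X_y[OF subsetD[OF N(1)]]] irrefl by auto
    have ty_NM: "ty p N = ty p M0" using N(3) X_ty by simp
    show ?thesis
      unfolding thinned_def
    proof (intro conjI ballI impI)
      show "insert y N \<subseteq> M" using N(1) X_sub M by auto
      show "countable (insert y N)" using X_cnt N(1) countable_subset by blast
      have "ty p (N \<union> {y}) = ty p (M0 \<union> {y})"
        by (rule ty_Un_left) (use N(1) X_sub M yC X_y less_y ty_NM in \<open>auto simp: sep_def\<close>)
      then show "ty p (insert y N) = ty p M" using M by simp
      show "F \<inter> M \<subseteq> insert y N" using N(4) M(1) by auto
      show "ty p (bel (insert y N) b) = ty p (bel M b)" if "b \<in> insert y N" for b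
      proof (cases "b = y")
        case True then show ?thesis using bel_y belM_y ty_NM by simp
      next
        case False
        with that have "b \<in> N" "b \<in> M0" using N(1) X_sub by auto
        then show ?thesis using bel belM X_bel N(1) by auto
      qed
      show "ty p (abv (insert y N) b \<union> R) = ty p (abv C b)" if "b \<in> insert y N" for b
      proof (cases "b = y")
        case True then show ?thesis using abv_y ty_y by simp
      next
        case False
        with that have "b \<in> N" by simp
        then show ?thesis using abv N_abv by simp
      qed
      show "\<not> own_limit p (insert y N) b" if "b \<in> insert y N" for b
      proof (cases "b = y")
        case False
        with that have "b \<in> N" by simp
        then show ?thesis using own_limit_cong[OF bel] X_lim N(1) by blast
      qed (use y_lim in simp)
      show "b \<in> insert y N" if "b \<in> M" "abv M b = {}" for b
      proof -
        have "y \<in> abv M b" if "b \<in> M0" using that M(1,3) less_y by auto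
        then have "b \<notin> M0" using that(2) by auto
        then show ?thesis using that(1) M by auto
      qed
    qed
  qed
  show ?thesis
  proof (cases "own_limit p (insert y X) y")
    case False
    have "thinned p F M R (insert y X)"
      by (rule complete) (use False X_F X_abv in auto)
    then show ?thesis unfolding M_def by blast
  next
    case True
    have bel_yX: "bel (insert y X) y = X" using X_y irrefl by auto
    define W where "W = {x \<in> X. chr p x = chr p y}"
    have W: "X \<noteq> {}" "\<forall>b\<in>X. \<exists>x\<in>W. b \<sqsubset> x"
      using True unfolding own_limit_def bel_yX W_def by auto
    obtain w where w: "\<And>n. w n \<in> W" "\<And>n. w n \<sqsubset> w (Suc n)"
      and cof: "\<And>x. x \<in> X \<Longrightarrow> \<exists>n. x \<sqsubset> w n" and wF: "\<And>x. x \<in> F \<inter> X \<Longrightarrow> x \<sqsubset> w 0"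
      by (rule cofinal_sequence[OF X_sub(2) _ W X_cnt, of "F \<inter> X"]) (use F in \<open>auto simp: W_def\<close>)
    have wX: "w n \<in> X" for n using w(1) by (simp add: W_def)
    define Z where "Z = E \<union> X"
    have EX: "E \<lless> X" "E \<lless> M0"
    proof -
      have "x \<sqsubset> z" if "x \<in> E" "z \<in> M0" for x z
      proof -
        have "z \<notin> E" "z \<in> D" using that(2) M by (auto simp: M0_def D0)
        moreover have "\<not> z \<sqsubset> x" using that(1) E(1) DC calculation by (auto simp: down_closed_def)
        ultimately show ?thesis using cmp[of x z] that(1) E(2) by blast
      qed
      then show "E \<lless> X" "E \<lless> M0" using X_sub by (auto simp: sep_def)
    qed
    have ZC: "Z \<subseteq> C" using X_sub E by (auto simp: Z_def down_closed_def)
    have EC: "E \<subseteq> C" using E by (auto simp: down_closed_def)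
    obtain r :: "nat \<Rightarrow> nat" and s where r: "strict_mono r"
      and "\<forall>m n. m < n \<longrightarrow> ty p (iv Z (w (r m)) (w (r n))) = s"
      using homogeneous_subsequence[OF ZC, of p w] by blast
    then have hom: "ty p (iv Z (w (r m)) (w (r n))) = s" if "m < n" for m n using that by blast
    define v where "v n = w (r n)" for n
    have v: "v n \<in> X" "chr p (v n) = chr p y" "v n \<sqsubset> v (Suc n)" for n
      using wX w(1) seq_less[of w, OF w(2)] r by (auto simp: v_def W_def strict_mono_def)
    have cof_v: "\<exists>n. z \<sqsubset> v n" if "z \<in> X" for z
    proof -
      from cof[OF that] obtain n where n: "z \<sqsubset> w n" by blast
      have "n \<le> r n" using r by (rule strict_mono_imp_increasing)
      then have "z \<sqsubset> w (r n)" using n seq_less[of w, OF w(2), of n "r n"] trans by (cases "n = r n") auto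
      then show ?thesis unfolding v_def by blast
    qed
    have cof_Z: "\<exists>n. z \<sqsubset> v n" if "z \<in> Z" for z
      using that cof_v EX(1) v(1)[of 0] unfolding Z_def sep_def by blast
    have belZ: "bel Z (v n) = E \<union> bel X (v n)" for n
      using EX(1) v(1) by (auto simp: Z_def sep_def)
    have tyZ: "ty p Z = ty p (bel C y)"
    proof -
      have "ty p (E \<union> X) = ty p (E \<union> M0)"
        by (rule ty_Un_right) (use EC X_sub M EX X_ty in auto)
      moreover have "E \<union> M0 = D0" using \<open>E \<subseteq> D0\<close> by (auto simp: M0_def)
      ultimately show ?thesis by (simp add: Z_def D0_def)
    qed
    \<comment> \<open>The equalities lead from \<open>Z\<close> below \<open>v n\<close> to
      \<open>C\<close> below \<open>v n\<close>, then by equality of characters to \<open>C\<close>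
      below \<open>y\<close>, and back to \<open>Z\<close>.\<close>
    have pre: "ty p (bel Z (v n)) = ty p Z" for n
    proof -
      have vM: "v n \<in> M0" "v n \<in> D0" using v(1) X_sub M by auto
      have "ty p (E \<union> bel X (v n)) = ty p (E \<union> bel M0 (v n))"
        by (rule ty_Un_right) (use EC X_sub M EX X_bel v(1) in \<open>auto simp: sep_def\<close>)
      moreover have "E \<union> bel M0 (v n) = bel C (v n)"
      proof (intro set_eqI iffI)
        fix x assume "x \<in> bel C (v n)"
        then have x: "x \<in> C" "x \<sqsubset> v n" by auto
        then have "x \<sqsubset> y" using vM(2) less_y trans by blast
        then show "x \<in> E \<union> bel M0 (v n)" using x by (auto simp: M0_def D0_def)
      next
        fix x assume "x \<in> E \<union> bel M0 (v n)"
        then show "x \<in> bel C (v n)" using EX(2) vM(1) EC M(4) by (auto simp: sep_def)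
      qed
      moreover have "ty p (bel C (v n)) = ty p (bel C y)" using v(2) by (simp add: chr_def)
      ultimately show ?thesis using belZ tyZ by simp
    qed
    have tl: "ty p {z \<in> Z. \<not> z \<sqsubset> v 0} = s"
      by (rule limit_absorb[OF ZC _ v(3) cof_Z _ pre]) (use v(1) hom in \<open>auto simp: Z_def v_def\<close>)
    have hom0: "ty p (iv Z (v 0) (v 1)) = s" using hom[of 0 1] by (simp add: v_def)
    have below_v0: "z \<in> E \<Longrightarrow> z \<sqsubset> v 0" for z using EX(1) v(1) by (auto simp: sep_def)
    have cmpX: "a \<sqsubset> b \<or> a = b \<or> b \<sqsubset> a" if "a \<in> X" "b \<in> X" for a b
      using total that X_sub by blast
    \<comment> \<open>The cut is at index 1, not 0: it retains the interval from \<open>v 0\<close>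
      to \<open>v 1\<close>, whose type \<open>s\<close> is that of the whole tail from
      \<open>v 0\<close>.\<close>
    define N where "N = bel X (v 1)"
    have v01: "v 0 \<sqsubset> v 1" using v(3)[of 0] by simp
    have ty_N: "ty p N = ty p X"
    proof -
      have le: "a \<sqsubset> b" if "a \<sqsubset> v 0" "\<not> b \<sqsubset> v 0" "b \<in> X" for a b
        using that cmpX[OF v(1)[of 0] that(3)] trans by blast
      have "N = bel X (v 0) \<union> iv Z (v 0) (v 1)"
        using below_v0 v01 trans by (auto simp: N_def iv_def Z_def)
      moreover have "X = bel X (v 0) \<union> {z \<in> Z. \<not> z \<sqsubset> v 0}"
        using below_v0 by (auto simp: Z_def)
      moreover have "ty p (bel X (v 0) \<union> iv Z (v 0) (v 1)) = ty p (bel X (v 0) \<union> {z \<in> Z. \<not> z \<sqsubset> v 0})"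
        by (rule ty_Un_right) (use X_sub ZC tl hom0 le below_v0 in \<open>auto simp: iv_def sep_def Z_def\<close>)
      ultimately show ?thesis by metis
    qed
    have v1M: "v 1 \<in> X" "chr p (v 1) = chr p y" using v by auto
    have "thinned p F M R (insert y N)"
    proof (rule complete)
      show "N \<subseteq> X" by (auto simp: N_def)
      show "bel X b \<subseteq> N" if "b \<in> N" for b using that trans by (auto simp: N_def)
      show "F \<inter> M0 \<subseteq> N"
      proof
        fix x assume "x \<in> F \<inter> M0"
        then have x: "x \<in> F \<inter> X" using X_F by auto
        have "x \<sqsubset> v 0" using wF[OF x] seq_less[of w, OF w(2), of 0 "r 0"] trans
          by (cases "r 0 = 0") (auto simp: v_def)
        then show "x \<in> N" using x v01 trans by (auto simp: N_def)
      qed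
      \<comment> \<open>Deleting \<open>[v\<^sub>1, y)\<close> is harmless on the right as \<open>v\<^sub>1\<close> and \<open>y\<close> have the same
        character.\<close>
      show "ty p (abv N b \<union> R0) = ty p (abv C b)" if "b \<in> N" for b
      proof -
        have b: "b \<in> X" "b \<sqsubset> v 1" using that by (auto simp: N_def)
        have XR0: "X \<lless> R0"
          by (rule sep_mono[OF R0(2)]) (use X_sub(1) M(3) in auto)
        then have v1R: "{v 1} \<lless> abv X (v 1) \<union> R0"
          using v1M(1) by (auto simp: sep_def)
        have *: "ty p R0 = ty p ({v 1} \<union> (abv X (v 1) \<union> R0))"
        proof -
          have "ty p (abv X (v 1) \<union> R0) = ty p R"
            using X_abv[OF v1M(1)] v1M(2) ty_y by (simp add: chr_def)
          then have "ty p ({v 1} \<union> (abv X (v 1) \<union> R0)) = ty p ({y} \<union> R)"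
            using v1M R0 X_sub R yC yR v1R
            by (intro ty_Un ty_singleton) (auto simp: chr_def sep_def)
          then show ?thesis by (simp add: R0_def)
        qed
        have "ty p (abv N b \<union> R0) = ty p (abv N b \<union> ({v 1} \<union> (abv X (v 1) \<union> R0)))"
          by (rule ty_Un_right[OF _ _ _ _ *])
            (use X_sub R0(1) v1M(1) XR0 in \<open>auto simp: sep_def N_def intro: trans\<close>)
        also have "abv N b \<union> ({v 1} \<union> (abv X (v 1) \<union> R0)) = abv X b \<union> R0"
        proof -
          have "b \<sqsubset> x" if "v 1 \<sqsubset> x" for x using b(2) that by (rule trans)
          then show ?thesis using b v1M(1) cmpX[OF v1M(1)] unfolding N_def bel_def abv_def by blast
        qed
        finally show ?thesis using X_abv[OF b(1)] by simp
      qed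
      show "\<not> own_limit p (insert y N) y"
      proof -
        have "bel (insert y N) y = bel X (v 1)" using X_y irrefl by (auto simp: N_def)
        then show ?thesis using X_lim[OF v1M(1)] v1M(2) by (simp add: own_limit_def)
      qed
    qed (rule ty_N)
    then show ?thesis unfolding M_def by blast
  qed
qed

section \<open>Intervals of cofinality omega\<close>

text \<open>The interval is divided into omega blocks, each ending inside a smaller initial segment,
  and the blocks are thinned independently. Every block keeps its exact type, so sums of blocks keep
  theirs.\<close>

lemma thin_omega_step:
  assumes D: "down_closed D" and E: "down_closed E" "E \<subseteq> D" and R: "R \<subseteq> C" "D \<lless> R"
    and ctx: "\<And>b. b \<in> D \<Longrightarrow> ty p (abv D b \<union> R) = ty p (abv C b)"
    and w: "\<And>n. w n \<in> D - E" "\<And>n. w n \<sqsubset> w (Suc n)" "\<And>x. x \<in> D - E \<Longrightarrow> \<exists>n. x \<sqsubset> w n"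
    and IH: "\<And>D'. down_closed D' \<Longrightarrow> D' \<subset> D \<Longrightarrow> thinnable p F D'"
  shows "\<exists>M'. thinned p F (D - E) R M'"
proof -
  have DC: "D \<subseteq> C" "E \<subseteq> C" using D E by (auto simp: down_closed_def)
  have wC: "w n \<in> C" "w n \<in> D" "w n \<notin> E" for n using w(1) DC by auto
  note less = seq_less[of w, OF w(2)]
  define S where "S n = (case n of 0 \<Rightarrow> E | Suc m \<Rightarrow> {x \<in> C. \<not> w m \<sqsubset> x})" for n
  have S0: "S 0 = E" and S_Suc: "S (Suc n) = {x \<in> C. \<not> w n \<sqsubset> x}" for n by (simp_all add: S_def)
  have cmp: "a \<sqsubset> b \<or> a = b \<or> b \<sqsubset> a" if "a \<in> C" "b \<in> C" for a b using that total by blast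
  have S_dc: "down_closed (S n)" for n
    using E trans by (cases n) (auto simp: S0 S_Suc down_closed_def)
  have S_D: "S n \<subseteq> D" for n
  proof (cases n)
    case (Suc m)
    have "x \<in> D" if "x \<in> C" "\<not> w m \<sqsubset> x" for x
      using cmp[OF that(1) wC(1)[of m]] that D wC(2)[of m] unfolding down_closed_def by blast
    then show ?thesis by (auto simp: Suc S_Suc)
  qed (use E in \<open>simp add: S0\<close>)
  have S_psub: "S (Suc n) \<subset> D" for n
    using S_D[of "Suc n"] wC(2)[of "Suc n"] w(2)[of n] by (auto simp: S_Suc)
  have S_step: "S n \<subseteq> S (Suc n)" for n
  proof (cases n)
    case 0
    have "\<not> w 0 \<sqsubset> x" if "x \<in> E" for x using that E(1) wC[of 0] by (auto simp: down_closed_def)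
    then show ?thesis using DC by (auto simp: 0 S0 S_Suc)
  next
    case (Suc m) then show ?thesis using w(2)[of m] trans by (auto simp: S_Suc)
  qed
  have S_mono: "S m \<subseteq> S n" if "m \<le> n" for m n using that S_step by (rule lift_Suc_mono_le[rotated])
  have S_less: "x \<sqsubset> y" if "x \<in> S n" "y \<in> C" "y \<notin> S n" for x y n
    using that S_dc[of n] cmp[of x y] unfolding down_closed_def by blast
  define M where "M n = S (Suc n) - S n" for n
  \<comment> \<open>What follows block \<open>n\<close> is taken with the later blocks unthinned,
    which makes the blocks independent; the thinned versions are substituted afterwards.\<close>
  define Rn where "Rn n = (D - S (Suc n)) \<union> R" for n
  have MC: "M n \<subseteq> D" "M n \<subseteq> C" for n using S_D[of "Suc n"] DC by (auto simp: M_def)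
  have M_inc: "increasing M"
    unfolding increasing_def sep_def
  proof (intro allI impI ballI)
    fix i j x y assume "i < j" "x \<in> M i" "y \<in> M j"
    then show "x \<sqsubset> y" using S_less[of x "Suc i" y] S_mono[of "Suc i" j] MC(2)[of j]
      by (auto simp: M_def)
  qed
  have M_tail: "D - S n = (\<Union>i. M (n + i))" for n
  proof (intro set_eqI iffI)
    fix x assume x: "x \<in> D - S n"
    then have "x \<notin> E" using S_mono[of 0 n] by (auto simp: S0)
    with x w(3) obtain k where "x \<sqsubset> w k" by blast
    then have "x \<in> S (Suc k)" using x DC asym[OF \<open>x \<sqsubset> w k\<close>] by (auto simp: S_Suc)
    define j where "j = (LEAST j. x \<in> S j)"
    have j: "x \<in> S j" "\<And>i. i < j \<Longrightarrow> x \<notin> S i"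
      unfolding j_def using LeastI[of "\<lambda>j. x \<in> S j", OF \<open>x \<in> S (Suc k)\<close>] not_less_Least by blast+
    have "n < j" using j(1) x S_mono[of j n] by (meson DiffD2 not_le subsetD)
    then obtain i where "j = Suc (n + i)" by (auto dest: less_imp_Suc_add)
    then have "x \<in> M (n + i)" using j by (simp add: M_def)
    then show "x \<in> (\<Union>i. M (n + i))" by blast
  next
    fix x assume "x \<in> (\<Union>i. M (n + i))"
    then show "x \<in> D - S n" using MC(1) S_mono[OF le_add1, of n] unfolding M_def by blast
  qed
  have "\<exists>X. thinned p F (M n) (Rn n) X" for n
  proof -
    have Rn: "Rn n \<subseteq> C" "S (Suc n) \<lless> Rn n"
      using R DC S_less[of _ "Suc n"] S_D[of "Suc n"] by (auto simp: Rn_def sep_def)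
    have "abv D b \<union> R = abv (S (Suc n)) b \<union> Rn n" if "b \<in> S (Suc n)" for b
      using S_less[OF that] S_D[of "Suc n"] DC by (auto simp: Rn_def)
    then have "ty p (abv (S (Suc n)) b \<union> Rn n) = ty p (abv C b)" if "b \<in> S (Suc n)" for b
      using ctx[of b] that S_D[of "Suc n"] by auto
    from thinnableD[OF IH[OF S_dc S_psub] S_dc S_step Rn this] show ?thesis
      unfolding M_def by blast
  qed
  then obtain X where X: "\<And>n. thinned p F (M n) (Rn n) (X n)" by metis
  have X_sub: "X n \<subseteq> M n" "X n \<subseteq> C" and X_cnt: "countable (X n)" and X_ty: "ty p (X n) = ty p (M n)"
    and X_F: "F \<inter> M n \<subseteq> X n" for n
    using X[of n] MC(2)[of n] unfolding thinned_def by auto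
  have X_bel: "ty p (bel (X n) b) = ty p (bel (M n) b)"
    and X_abv: "ty p (abv (X n) b \<union> Rn n) = ty p (abv C b)"
    and X_lim: "\<not> own_limit p (X n) b" if "b \<in> X n" for b n
    using X[of n] that unfolding thinned_def by auto
  have X_max: "y \<in> X n" if "y \<in> M n" "abv (M n) y = {}" for y n
    using X[of n] that unfolding thinned_def by auto
  have M_less: "x \<sqsubset> y" if "x \<in> M i" "y \<in> M j" "i < j" for x y i j
    using M_inc that by (auto simp: increasing_def sep_def)
  have X_less: "x \<sqsubset> y" if "x \<in> X i" "y \<in> X j" "i < j" for x y i j
    using M_less that X_sub by blast
  have X_inc: "increasing X" using X_less by (auto simp: increasing_def sep_def)
  have split_bel: "bel (\<Union>i. Y i) b = (\<Union>i. if i < n then Y i else {}) \<union> bel (Y n) b"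
    and split_abv: "abv (\<Union>i. Y i) b = abv (Y n) b \<union> (\<Union>i. Y (Suc n + i))"
    if Y: "increasing Y" and b: "b \<in> Y n" for Y :: "nat \<Rightarrow> 'a set" and b n
  proof -
    have *: "i < n \<or> i = n \<or> (\<exists>k. i = Suc n + k)" for i
      by (metis add_Suc less_imp_Suc_add nat_neq_iff)
    have lt: "x \<sqsubset> b" if "x \<in> Y i" "i < n" for x i using Y b that by (auto simp: increasing_def sep_def)
    have gt: "b \<sqsubset> x" if "x \<in> Y (Suc n + k)" for x k 
    proof -
      have "n < Suc n + k" by simp
      then show ?thesis using Y b that unfolding increasing_def sep_def by blast
    qed
    show "bel (\<Union>i. Y i) b = (\<Union>i. if i < n then Y i else {}) \<union> bel (Y n) b"
    proof (intro set_eqI iffI)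
      fix x assume "x \<in> bel (\<Union>i. Y i) b"
      then obtain i where i: "x \<in> Y i" "x \<sqsubset> b" by auto
      from *[of i] show "x \<in> (\<Union>i. if i < n then Y i else {}) \<union> bel (Y n) b"
        using i gt asym[OF i(2)] by (elim disjE exE) auto
    qed (use lt b in \<open>auto split: if_splits\<close>)
    show "abv (\<Union>i. Y i) b = abv (Y n) b \<union> (\<Union>i. Y (Suc n + i))"
    proof (intro set_eqI iffI)
      fix x assume "x \<in> abv (\<Union>i. Y i) b"
      then obtain i where i: "x \<in> Y i" "b \<sqsubset> x" by auto
      from *[of i] show "x \<in> abv (Y n) b \<union> (\<Union>i. Y (Suc n + i))"
        using i lt asym[OF i(2)] by (elim disjE exE) auto
    next
      fix x assume "x \<in> abv (Y n) b \<union> (\<Union>i. Y (Suc n + i))"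
      then show "x \<in> abv (\<Union>i. Y i) b" using gt by fastforce
    qed
  qed
  define N where "N = (\<Union>i. X i)"
  have M_un: "D - E = (\<Union>i. M i)" using M_tail[of 0] by (simp add: S0)
  have w_max: "w n \<in> M n" "x \<in> M n \<Longrightarrow> \<not> w n \<sqsubset> x" for n x
  proof -
    have "w n \<notin> S n" using w(1)[of n] w(2) by (cases n) (auto simp: S0 S_Suc)
    then show "w n \<in> M n" "x \<in> M n \<Longrightarrow> \<not> w n \<sqsubset> x" using wC irrefl by (auto simp: M_def S_Suc)
  qed
  have "thinned p F (D - E) R N"
    unfolding thinned_def
  proof (intro conjI ballI impI)
    show "N \<subseteq> D - E" using X_sub(1) by (auto simp: N_def M_un)
    show "countable N" using X_cnt by (simp add: N_def)
    show "ty p N = ty p (D - E)"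
      unfolding N_def M_un
      by (rule ty_UN) (use X_sub MC X_ty X_less M_inc in \<open>auto simp: increasing_def sep_def\<close>)
    show "F \<inter> (D - E) \<subseteq> N" using X_F by (auto simp: N_def M_un)
    show "ty p (bel N b) = ty p (bel (D - E) b)" if "b \<in> N" for b
    proof -
      from that obtain n where n: "b \<in> X n" by (auto simp: N_def)
      then have bM: "b \<in> M n" using X_sub by blast
      show ?thesis
        unfolding N_def M_un split_bel[OF X_inc n] split_bel[OF M_inc bM]
      proof (rule ty_Un)
        \<comment> \<open>Blocks from \<open>n\<close> on are replaced by empty ones, which turns a
          finite initial sum into an instance of \<open>ty_UN\<close>.\<close>
        show "ty p (\<Union>i. if i < n then X i else {}) = ty p (\<Union>i. if i < n then M i else {})"
        proof (rule ty_UN)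
          show "increasing (\<lambda>i. if i < n then X i else {})" "increasing (\<lambda>i. if i < n then M i else {})"
            using X_less M_less by (auto simp: increasing_def sep_def)
        qed (use X_sub MC X_ty in auto)
        show "(\<Union>i. if i < n then X i else {}) \<lless> bel (X n) b"
          using X_less by (auto simp: sep_def split: if_splits)
        show "(\<Union>i. if i < n then M i else {}) \<lless> bel (M n) b"
          using M_less by (auto simp: sep_def split: if_splits)
        show "ty p (bel (X n) b) = ty p (bel (M n) b)" using X_bel[OF n] .
      qed (auto dest: subsetD[OF X_sub(2)] subsetD[OF MC(2)] split: if_splits)
    qed
    show "ty p (abv N b \<union> R) = ty p (abv C b)" if "b \<in> N" for b
    proof -
      from that obtain n where n: "b \<in> X n" by (auto simp: N_def)
      have DR: "x \<sqsubset> y" if "x \<in> M i" "y \<in> R" for x y i using that R(2) MC(1) by (auto simp: sep_def)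
      have "ty p (\<Union>i. X (Suc n + i)) = ty p (\<Union>i. M (Suc n + i))"
        by (rule ty_UN) (use X_sub MC X_ty X_less M_less in \<open>auto simp: increasing_def sep_def\<close>)
      then have "ty p ((\<Union>i. X (Suc n + i)) \<union> R) = ty p ((\<Union>i. M (Suc n + i)) \<union> R)"
        by (intro ty_Un_left)
          (use R(1) in \<open>auto simp: sep_def dest: subsetD[OF X_sub(2)] subsetD[OF MC(2)]
            intro: DR DR[OF subsetD[OF X_sub(1)]]\<close>)
      then have tails: "ty p ((\<Union>i. X (Suc n + i)) \<union> R) = ty p (Rn n)"
        by (simp only: Rn_def M_tail[of "Suc n"])
      have "X n \<lless> Rn n" "X n \<lless> (\<Union>i. X (Suc n + i)) \<union> R"
        using DR X_less X_sub M_less unfolding Rn_def M_tail[of "Suc n"] sep_def by fastforce+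
      then have "ty p (abv (X n) b \<union> ((\<Union>i. X (Suc n + i)) \<union> R)) = ty p (abv (X n) b \<union> Rn n)"
        by (intro ty_Un_right tails)
          (use X_sub R(1) DC in \<open>auto simp: Rn_def elim: sep_mono\<close>)
      then show ?thesis
        unfolding N_def split_abv[OF X_inc n] using X_abv[OF n] by (simp add: Un_assoc)
    qed
    show "\<not> own_limit p N y" if "y \<in> N" for y
    proof
      assume lim: "own_limit p N y"
      from that obtain n where n: "y \<in> X n" by (auto simp: N_def)
      have le: "k \<le> n" if "x \<in> X k" "x \<sqsubset> y" for x k
        using X_less[OF n that(1)] asym[OF that(2)] by (meson not_le)
      have step: "\<exists>k x. x \<in> X k \<and> x \<sqsubset> y \<and> b \<sqsubset> x \<and> chr p x = chr p y" if "b \<in> X k" "b \<sqsubset> y" for b k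
      proof -
        have "b \<in> bel N y" using that by (auto simp: N_def)
        with lim obtain x where "x \<in> bel N y" "b \<sqsubset> x" "chr p x = chr p y"
          unfolding own_limit_def by blast
        then show ?thesis by (auto simp: N_def)
      qed
      show False
      proof (cases "bel (X n) y = {}")
        case False
        \<comment> \<open>Between a point of block \<open>n\<close> and \<open>y\<close> there are
          only points of block \<open>n\<close>, so the limit would already occur inside
          \<open>X n\<close>.\<close>
        have "\<exists>x\<in>bel (X n) y. b \<sqsubset> x \<and> chr p x = chr p y" if "b \<in> bel (X n) y" for b
        proof -
          from that have b: "b \<in> X n" "b \<sqsubset> y" by auto
          from step[OF this] obtain k x where x: "x \<in> X k" "x \<sqsubset> y" "b \<sqsubset> x" "chr p x = chr p y"
            by blast
          have "\<not> k < n" using X_less[OF x(1) b(1)] asym[OF x(3)] by blast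
          then have "k = n" using le[OF x(1,2)] by simp
          then show ?thesis using x by auto
        qed
        then have "own_limit p (X n) y" using False by (simp add: own_limit_def)
        then show False using X_lim[OF n] by blast
      next
        case True
        from lim obtain x where "x \<in> bel N y" unfolding own_limit_def by blast
        then obtain k where x: "x \<in> X k" "x \<sqsubset> y" by (auto simp: N_def)
        with True have "k \<noteq> n" by auto
        then have "k < n" using le[OF x] by simp
        then obtain m where m: "n = Suc m" using gr0_conv_Suc by (metis gr_implies_not0 not0_implies_Suc)
        \<comment> \<open>The last element of the preceding block has been retained and no point of
          \<open>N\<close> lies between it and \<open>y\<close>, so \<open>y\<close> is no limit at
          all.\<close>
        have "abv (M m) (w m) = {}" using w_max(2) by auto
        then have wm: "w m \<in> X m" using X_max w_max(1) by blast
        have "w m \<sqsubset> y" using X_less[OF wm n] m by simp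
        from step[OF wm this] obtain k' x' where x': "x' \<in> X k'" "x' \<sqsubset> y" "w m \<sqsubset> x'" by blast
        have "\<not> k' < m" using X_less[OF x'(1) wm] asym[OF x'(3)] by blast
        moreover have "k' \<noteq> m" using w_max(2) x'(1,3) X_sub(1) by blast
        ultimately have "k' = n" using le[OF x'(1,2)] m by simp
        then show False using x' True by auto
      qed
    qed
    show "y \<in> N" if "y \<in> D - E" "abv (D - E) y = {}" for y
    proof -
      from w(3)[OF that(1)] obtain n where "w n \<in> abv (D - E) y" using w(1) by auto
      then show ?thesis using that(2) by simp
    qed
  qed
  then show ?thesis by blast
qed

section \<open>Intervals of uncountable cofinality\<close>

text \<open>A closing-off argument: an omega-sequence \<open>b\<close> is built such that each step
  provides witnesses for all keys. As no omega-sequence is cofinal, its supremum \<open>c\<close>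
  lies inside the interval; the part below \<open>c\<close> has the type of the whole and falls
  under the induction hypothesis.\<close>

lemma thin_reflect_step:
  assumes D: "down_closed D" and E: "down_closed E" "E \<subseteq> D" and R: "R \<subseteq> C" "D \<lless> R"
    and ctx: "\<And>b. b \<in> D \<Longrightarrow> ty p (abv D b \<union> R) = ty p (abv C b)"
    and ne: "D - E \<noteq> {}" and no_max: "\<forall>x\<in>D - E. \<exists>y\<in>D - E. x \<sqsubset> y"
    and no_seq: "\<And>w :: nat \<Rightarrow> 'a. (\<And>n. w n \<in> D - E) \<Longrightarrow> (\<And>n. w n \<sqsubset> w (Suc n)) \<Longrightarrow>
      \<exists>x\<in>D - E. \<forall>n. \<not> x \<sqsubset> w n"
    and F: "finite F"
    and IH: "\<And>D'. down_closed D' \<Longrightarrow> D' \<subset> D \<Longrightarrow> thinnable p F D'"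
  shows "\<exists>M'. thinned p F (D - E) R M'"
proof -
  have DC: "D \<subseteq> C" "E \<subseteq> C" using D E by (auto simp: down_closed_def)
  define M where "M = D - E"
  have MC: "M \<subseteq> C" "M \<subseteq> D" using DC by (auto simp: M_def)
  have cmp: "a \<sqsubset> b \<or> a = b \<or> b \<sqsubset> a" if "a \<in> C" "b \<in> C" for a b using that total by blast
  note fin_bound = finite_bound[OF MC(1) subset_refl ne[folded M_def] no_max[folded M_def]]
  \<comment> \<open>Records how \<open>e\<close> looks from \<open>b\<close>: its color, the type of
    the gap between \<open>b\<close> and \<open>e\<close>, and the type of everything in
    \<open>M\<close> after \<open>e\<close>.\<close>
  define key where "key b e = (col e, ty p (bel (abv M b) e), ty p (abv M e))" for b e
  have key_fin: "finite (key b ` abv M b)" for b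
  proof (rule finite_subset)
    show "key b ` abv M b \<subseteq> col ` C \<times> ty p ` Pow C \<times> ty p ` Pow C"
      using MC by (auto simp: key_def)
  qed (use finite_col finite_ty in auto)
  have next_ex: "\<exists>c\<in>M. b \<sqsubset> c \<and> (\<forall>e\<in>abv M b. \<exists>e'\<in>abv M b. e' \<sqsubset> c \<and> key b e' = key b e)"
    if "b \<in> M" for b
  proof -
    \<comment> \<open>Finitely many representatives of all keys over \<open>b\<close>; any
      \<open>c\<close> beyond them reflects every key.\<close>
    obtain T where T: "T \<subseteq> abv M b" "finite T" "key b ` abv M b = key b ` T"
      using finite_subset_image[OF key_fin order_refl] by metis
    have "insert b T \<subseteq> M" using T(1) that by auto
    from fin_bound[OF _ this] T(2) obtain c where c: "c \<in> M" "\<forall>x\<in>insert b T. x \<sqsubset> c" by auto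
    have "\<exists>e'\<in>abv M b. e' \<sqsubset> c \<and> key b e' = key b e" if "e \<in> abv M b" for e
    proof -
      have "key b e \<in> key b ` T" using that T(3) by blast
      then obtain e' where "e' \<in> T" "key b e' = key b e" by (metis imageE)
      then show ?thesis using c(2) T(1) by blast
    qed
    then show ?thesis using c by blast
  qed
  obtain b where b: "\<And>n. b n \<in> M" and b0: "\<forall>x\<in>F \<inter> M. x \<sqsubset> b 0"
    and b_less: "\<And>n. b n \<sqsubset> b (Suc n)"
    and b_wit: "\<And>n e. e \<in> abv M (b n) \<Longrightarrow> \<exists>e'\<in>abv M (b n). e' \<sqsubset> b (Suc n) \<and> key (b n) e' = key (b n) e"
  proof -
    let ?Q = "\<lambda>b c. b \<sqsubset> c \<and> (\<forall>e\<in>abv M b. \<exists>e'\<in>abv M b. e' \<sqsubset> c \<and> key b e' = key b e)"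
    have "\<exists>b. \<forall>n::nat. (b n \<in> M \<and> (n = 0 \<longrightarrow> (\<forall>x\<in>F \<inter> M. x \<sqsubset> b n))) \<and> ?Q (b n) (b (Suc n))"
    proof (rule dependent_nat_choice)
      show "\<exists>x. x \<in> M \<and> (0 = (0::nat) \<longrightarrow> (\<forall>y\<in>F \<inter> M. y \<sqsubset> x))"
        using fin_bound[of "F \<inter> M"] F by blast
    next
      fix x and n :: nat assume "x \<in> M \<and> (n = 0 \<longrightarrow> (\<forall>y\<in>F \<inter> M. y \<sqsubset> x))"
      with next_ex[of x] show "\<exists>y. (y \<in> M \<and> (Suc n = 0 \<longrightarrow> (\<forall>x\<in>F \<inter> M. x \<sqsubset> y))) \<and> ?Q x y"
        by blast
    qed
    then obtain b where "\<forall>n::nat. (b n \<in> M \<and> (n = 0 \<longrightarrow> (\<forall>x\<in>F \<inter> M. x \<sqsubset> b n))) \<and> ?Q (b n) (b (Suc n))"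
      by (elim exE)
    then show thesis by (intro that[of b]) simp_all
  qed
  have "\<exists>x\<in>M. \<forall>n. \<not> x \<sqsubset> b n" unfolding M_def by (rule no_seq) (use b b_less M_def in auto)
  then have "{x \<in> M. \<forall>n. \<not> x \<sqsubset> b n} \<noteq> {}" "{x \<in> M. \<forall>n. \<not> x \<sqsubset> b n} \<subseteq> C" using MC by auto
  \<comment> \<open>\<open>c\<close> is the supremum of the sequence within
    \<open>M\<close>.\<close>
  from least[OF this(2,1)] obtain c where c: "c \<in> M" "\<And>n. \<not> c \<sqsubset> b n"
    and c_least: "\<And>x. x \<in> M \<Longrightarrow> \<forall>n. \<not> x \<sqsubset> b n \<Longrightarrow> \<not> x \<sqsubset> c" by auto
  have cC: "c \<in> C" using c MC by blast
  have b_c: "b n \<sqsubset> c" for n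
    using cmp[OF cC, of "b (Suc n)"] c(2)[of "Suc n"] b b_less[of n] MC trans by blast
  define D1 where "D1 = bel C c"
  define M1 where "M1 = D1 - E"
  have D1: "down_closed D1" using trans by (auto simp: D1_def down_closed_def)
  have D1_D: "D1 \<subseteq> D" "c \<notin> D1" "c \<in> D"
    using c(1) MC D irrefl by (auto simp: D1_def down_closed_def)
  have E_D1: "E \<subseteq> D1"
  proof
    fix x assume x: "x \<in> E"
    then have "x \<noteq> c" "\<not> c \<sqsubset> x" using c(1) E(1) cC by (auto simp: M_def down_closed_def)
    then show "x \<in> D1" using cmp[OF cC, of x] x DC(2) by (auto simp: D1_def)
  qed
  have M1: "M1 = bel M c" using D1_D(1) DC by (auto simp: M1_def M_def D1_def)
  have M1_b: "\<exists>n. x \<sqsubset> b n" if "x \<in> M1" for x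
    using that c_least[of x] unfolding M1 by auto
  have M1C: "M1 \<subseteq> C" using MC M1 by auto
  \<comment> \<open>A point below \<open>c\<close> answers for itself. A point \<open>e\<close> from
    \<open>c\<close> on is answered by some \<open>f\<close> between \<open>b n\<close> and
    \<open>b (Suc n)\<close> with the same key, where \<open>b n\<close> lies beyond
    \<open>a\<close>; the induction hypothesis moves the right type of \<open>f\<close> from
    \<open>M\<close> to \<open>M1\<close>.\<close>
  have abv_ty: "ty s (abv M1 a) = ty s (abv M a)" if "s \<le> p" "a \<in> M1" for s a
    using that
  proof (induction s arbitrary: a)
    case 0 show ?case by (rule ty_0) (use M1C MC in auto)
  next
    case (Suc s)
    have same: "col e = col e \<and> ty s (bel (abv M1 a) e) = ty s (bel (abv M a) e) \<and>
        ty s (abv (abv M1 a) e) = ty s (abv (abv M a) e)" if e: "e \<in> abv M1 a" for e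
    proof -
      have e': "e \<in> M1" "a \<sqsubset> e" "e \<sqsubset> c" using e M1 by auto
      have "bel (abv M1 a) e = bel (abv M a) e"
        using trans[OF _ e'(3)] unfolding M1 bel_def abv_def by blast
      moreover have "abv (abv M1 a) e = abv M1 e" "abv (abv M a) e = abv M e"
        using trans[OF e'(2)] unfolding abv_def by blast+
      ultimately show ?thesis using Suc.IH[of e] Suc.prems e' by simp
    qed
    show ?case
    proof (rule ty_SucI)
      fix e assume "e \<in> abv M1 a"
      then show "\<exists>e'\<in>abv M a. col e = col e' \<and> ty s (bel (abv M1 a) e) = ty s (bel (abv M a) e') \<and>
          ty s (abv (abv M1 a) e) = ty s (abv (abv M a) e')"
        using same[of e] M1 by auto
    next
      fix e assume e: "e \<in> abv M a"
      show "\<exists>e'\<in>abv M1 a. col e' = col e \<and> ty s (bel (abv M1 a) e') = ty s (bel (abv M a) e) \<and>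
          ty s (abv (abv M1 a) e') = ty s (abv (abv M a) e)"
      proof (cases "e \<sqsubset> c")
        case True
        then have "e \<in> abv M1 a" using e M1 by auto
        then show ?thesis using same[of e] by blast
      next
        case False
        from M1_b[OF Suc.prems(2)] obtain n where n: "a \<sqsubset> b n" by blast
        have "c \<sqsubset> e \<or> c = e" using False cmp[OF cC, of e] e MC by auto
        then have "b n \<sqsubset> e" using b_c[of n] trans by blast
        then obtain f where f: "f \<in> abv M (b n)" "f \<sqsubset> b (Suc n)" "key (b n) f = key (b n) e"
          using b_wit[of e n] e by auto
        have f': "f \<in> M" "b n \<sqsubset> f" "f \<sqsubset> c" "a \<sqsubset> f"
          using f(1) trans[OF f(2) b_c] trans[OF n] by auto
        then have fM1: "f \<in> abv M1 a" by (auto simp: M1)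
        \<comment> \<open>The key controls the part beyond \<open>b n\<close>; the part up to
          \<open>b n\<close> is common to \<open>e\<close> and \<open>f\<close>.\<close>
        have split: "bel (abv M a) x = {z \<in> abv M a. \<not> b n \<sqsubset> z} \<union> bel (abv M (b n)) x" if "b n \<sqsubset> x" "x \<in> M" for x
        proof -
          have "z \<sqsubset> x" if "z \<in> M" "\<not> b n \<sqsubset> z" for z
            using cmp[of "b n" z] that b[of n] MC(1) \<open>b n \<sqsubset> x\<close> trans by blast
          moreover have "a \<sqsubset> z" if "b n \<sqsubset> z" for z using trans[OF n that] .
          ultimately show ?thesis unfolding bel_def abv_def by blast
        qed
        have sep: "{z \<in> abv M a. \<not> b n \<sqsubset> z} \<lless> bel (abv M (b n)) x" for x
          unfolding sep_def
        proof (intro ballI)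
          fix u z assume "u \<in> {z \<in> abv M a. \<not> b n \<sqsubset> z}" "z \<in> bel (abv M (b n)) x"
          then have "u \<in> C" "u = b n \<or> u \<sqsubset> b n" "b n \<sqsubset> z"
            using cmp[of "b n" u] b[of n] MC(1) by auto
          then show "u \<sqsubset> z" using trans by blast
        qed
        have "ty p (bel (abv M a) f) = ty p (bel (abv M a) e)"
          unfolding split[OF f'(2,1)] split[OF \<open>b n \<sqsubset> e\<close> conjunct1[OF e[unfolded mem_abv]]]
          by (rule ty_Un_right[OF _ _ sep sep]) (use f(3) MC in \<open>auto simp: key_def\<close>)
        then have "ty s (bel (abv M a) f) = ty s (bel (abv M a) e)"
          by (rule ty_mono) (use Suc.prems MC in auto)
        moreover have "ty s (abv M f) = ty s (abv M e)"
          by (rule ty_mono[of p]) (use f(3) Suc.prems MC in \<open>auto simp: key_def\<close>)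
        moreover have "abv (abv M a) f = abv M f" "abv (abv M a) e = abv M e"
          using trans[OF f'(4)] trans[of a e] e unfolding abv_def by blast+
        ultimately show ?thesis using same[OF fM1] fM1 f(3) by (auto simp: key_def)
      qed
    qed (use M1C MC in auto)
  qed
  have b0_M1: "b 0 \<in> M1" using b b_c M1 by auto
  have M1_ty: "ty p M1 = ty p M"
  proof -
    let ?B = "{z \<in> M. \<not> b 0 \<sqsubset> z}"
    have B: "z \<sqsubset> x" if "z \<in> ?B" "b 0 \<sqsubset> x" for z x
      using cmp[of "b 0" z] b[of 0] MC(1) that trans by blast
    have "M = ?B \<union> abv M (b 0)" by auto
    moreover have "M1 = ?B \<union> abv M1 (b 0)" using B b_c[of 0] by (auto simp: M1)
    moreover have "ty p (?B \<union> abv M1 (b 0)) = ty p (?B \<union> abv M (b 0))"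
      by (rule ty_Un_right) (use abv_ty[OF _ b0_M1] MC M1C B in \<open>auto simp: sep_def\<close>)
    ultimately show ?thesis by metis
  qed
  have R1: "D1 \<lless> R" using R(2) D1_D(1) by (rule sep_mono) simp
  \<comment> \<open>For a point of \<open>M1\<close> the part of \<open>M1\<close> above it is
    exchanged for that of \<open>M\<close>. For a point of \<open>E\<close> all of \<open>M1\<close>
    lies above it and is exchanged for \<open>M\<close>.\<close>
  have ctx1: "ty p (abv D1 a \<union> R) = ty p (abv C a)" if a: "a \<in> D1" for a
  proof (cases "a \<in> E")
    case False
    then have aM: "a \<in> M1" using a by (simp add: M1_def)
    have aE: "\<not> a \<sqsubset> x" if "x \<in> E" for x
      using E(1) that False a by (auto simp: down_closed_def D1_def)
    have "abv D1 a = abv M1 a" "abv D a = abv M a"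
      using aE by (auto simp: M1_def M_def)
    moreover have "ty p (abv M1 a \<union> R) = ty p (abv M a \<union> R)"
      by (rule ty_Un_left) (use abv_ty[OF _ aM] M1C MC R R1 in \<open>auto simp: sep_def M1_def\<close>)
    ultimately show ?thesis using ctx[of a] a D1_D(1) by auto
  next
    case True
    have sep: "E \<lless> D - E"
      unfolding sep_def
    proof (intro ballI)
      fix x z assume xz: "x \<in> E" "z \<in> D - E"
      then have "\<not> z \<sqsubset> x" "z \<noteq> x" using E(1) DC by (auto simp: down_closed_def)
      then show "x \<sqsubset> z" using cmp[of x z] xz DC by blast
    qed
    then have aM: "a \<sqsubset> z" if "z \<in> D - E" for z using True that by (simp add: sep_def)
    have "abv D1 a = abv E a \<union> M1" "abv D a = abv E a \<union> M"
      using aM E_D1 E(2) D1_D(1) by (auto simp: M1_def M_def)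
    moreover have "ty p (abv E a \<union> (M1 \<union> R)) = ty p (abv E a \<union> (M \<union> R))"
    proof (rule ty_Un_right)
      show "ty p (M1 \<union> R) = ty p (M \<union> R)"
        by (rule ty_Un_left) (use M1_ty M1C MC R R1 in \<open>auto simp: sep_def M1_def\<close>)
      show "abv E a \<lless> M1 \<union> R" "abv E a \<lless> M \<union> R"
        using sep R E(2) D1_D(1) by (auto simp: sep_def M1_def M_def)
    qed (use DC MC M1C R in auto)
    ultimately show ?thesis using ctx[of a] a D1_D(1) by (auto simp: Un_assoc)
  qed
  have "thinnable p F D1" by (rule IH[OF D1]) (use D1_D in auto)
  from thinnableD[OF this E(1) E_D1 R(1) R1 ctx1] obtain X where X: "thinned p F M1 R X"
    unfolding M1_def by metis
  \<comment> \<open>The sequence was started above the protected points of \<open>M\<close>, so they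
    all lie below \<open>c\<close>.\<close>
  have F_M1: "F \<inter> M \<subseteq> M1" using b0 trans[OF _ b_c[of 0]] by (auto simp: M1)
  have bel_eq: "bel M1 a = bel M a" if "a \<in> M1" for a
    using that trans by (auto simp: M1)
  have max: "abv M a \<noteq> {}" if a: "a \<in> M" for a
  proof -
    from no_max a obtain y where "y \<in> M" "a \<sqsubset> y" unfolding M_def by blast
    then have "y \<in> abv M a" by simp
    then show ?thesis by blast
  qed
  have "thinned p F M R X"
    unfolding thinned_def
  proof (intro conjI ballI impI)
    note X' = X[unfolded thinned_def]
    show "X \<subseteq> M" "countable X" "ty p X = ty p M" "F \<inter> M \<subseteq> X"
      using X' M1_ty F_M1 M1 by auto
    show "ty p (bel X a) = ty p (bel M a)" if "a \<in> X" for a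
      using X' bel_eq[of a] that by auto
    show "ty p (abv X a \<union> R) = ty p (abv C a)" "\<not> own_limit p X a" if "a \<in> X" for a
      using X' that by auto
    show "a \<in> X" if "a \<in> M" "abv M a = {}" for a using max that by blast
  qed
  then show ?thesis unfolding M_def by blast
qed

section \<open>Existence of the thin subset\<close>

text \<open>The interval \<open>D - E\<close> is empty, has a last element, has an increasing
  cofinal omega-sequence, or has neither; the last three cases reduce to shorter initial
  segments.\<close>

lemma thinnable_down_closed:
  assumes "down_closed D" "finite F"
  shows "thinnable p F D"
  using assms(1)
proof (induction rule: down_closed_induct)
  case (step D)
  show ?case
    unfolding thinnable_def
  proof (intro allI impI)
    fix E R
    assume H: "down_closed E" "E \<subseteq> D" "R \<subseteq> C" "D \<lless> R" and ctx: "\<forall>b\<in>D. ty p (abv D b \<union> R) = ty p (abv C b)"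
    have DC: "D \<subseteq> C" using step(1) by (auto simp: down_closed_def)
    consider "D - E = {}" | y where "y \<in> D - E" "abv D y = {}"
      | "D - E \<noteq> {}" "\<forall>x\<in>D - E. \<exists>y\<in>D - E. x \<sqsubset> y"
    proof (cases "\<exists>y\<in>D - E. abv D y = {}")
      case False
      have "\<exists>y\<in>D - E. x \<sqsubset> y" if "x \<in> D - E" for x
      proof -
        from False that obtain y where y: "y \<in> D" "x \<sqsubset> y" by (metis all_not_in_conv mem_abv)
        have "y \<notin> E" using H(1) y(2) that DC by (auto simp: down_closed_def)
        then show ?thesis using y by blast
      qed
      then show thesis using that by blast
    qed (use that in blast)
    then show "\<exists>M'. thinned p F (D - E) R M'"
    proof cases
      case 1
      then show ?thesis unfolding 1 by (intro exI[of _ "{}"]) (simp add: thinned_def)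
    next
      case (2 y)
      have "y \<in> C" "y \<in> D" using 2(1) DC by auto
      have "down_closed (bel C y)" using trans by (auto simp: down_closed_def)
      moreover have "bel C y \<subset> D"
        using step(1) \<open>y \<in> D\<close> irrefl by (auto simp: down_closed_def)
      ultimately have "thinnable p F (bel C y)" by (rule step(2))
      from thin_max_step[OF step(1) H _ 2 assms(2) this] ctx show ?thesis by blast
    next
      case 3
      show ?thesis
      proof (cases "\<exists>w::nat \<Rightarrow> 'a. (\<forall>n. w n \<in> D - E \<and> w n \<sqsubset> w (Suc n)) \<and> (\<forall>x\<in>D - E. \<exists>n. x \<sqsubset> w n)")
        case True
        then obtain w :: "nat \<Rightarrow> 'a" where w: "\<And>n. w n \<in> D - E" "\<And>n. w n \<sqsubset> w (Suc n)"
          "\<And>x. x \<in> D - E \<Longrightarrow> \<exists>n. x \<sqsubset> w n" by blast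
        show ?thesis
          by (rule thin_omega_step[OF step(1) H _ w step(2)]) (use ctx in auto)
      next
        case False
        show ?thesis
        proof (rule thin_reflect_step[OF step(1) H _ 3 _ assms(2) step(2)])
          show "\<exists>x\<in>D - E. \<forall>n. \<not> x \<sqsubset> w n" if "\<And>n. w n \<in> D - E" "\<And>n. w n \<sqsubset> w (Suc n)" for w :: "nat \<Rightarrow> 'a"
            using False that by blast
        qed (use ctx in auto)
      qed
    qed
  qed
qed

text \<open>\<open>F\<close> represents all characters and is protected, so every character of
  \<open>C\<close> occurs in \<open>J\<close>; conversely points of \<open>J\<close> keep their
  characters. This is one round of the game above rank \<open>p\<close>.\<close>

theorem ex_thin_subset:
  assumes "finite (chr p ` C)"
  shows "\<exists>J\<subseteq>C. countable J \<and> ty (Suc p) J = ty (Suc p) C \<and> (\<forall>y\<in>J. \<not> own_limit p J y)"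
proof -
  obtain F where F: "F \<subseteq> C" "finite F" "chr p ` C = chr p ` F"
    using finite_subset_image[OF assms order_refl] by metis
  have "down_closed C" "down_closed {}" by (auto simp: down_closed_def)
  from thinnableD[OF thinnable_down_closed[OF this(1) F(2)] this(2), of "{}" p]
  obtain J where J: "thinned p F C {} J" by (auto simp: sep_def)
  have J': "J \<subseteq> C" "countable J" "F \<subseteq> J" "\<And>y. y \<in> J \<Longrightarrow> \<not> own_limit p J y"
    and bel: "\<And>b. b \<in> J \<Longrightarrow> ty p (bel J b) = ty p (bel C b)"
    and abv: "\<And>b. b \<in> J \<Longrightarrow> ty p (abv J b) = ty p (abv C b)"
    using J F(1) unfolding thinned_def by auto
  have "ty (Suc p) J = ty (Suc p) C"
  proof (rule ty_SucI)
    show "\<exists>b\<in>C. col a = col b \<and> ty p (bel J a) = ty p (bel C b) \<and> ty p (abv J a) = ty p (abv C b)"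
      if "a \<in> J" for a
      using that bel abv J'(1) by blast
    show "\<exists>a\<in>J. col a = col b \<and> ty p (bel J a) = ty p (bel C b) \<and> ty p (abv J a) = ty p (abv C b)"
      if "b \<in> C" for b
    proof -
      have "chr p b \<in> chr p ` F" using that F(3) by blast
      then obtain a where "a \<in> F" "chr p b = chr p a" by blast
      then show ?thesis using bel[of a] abv[of a] J'(3) by (auto simp: chr_def)
    qed
  qed (use J' in auto)
  with J' show ?thesis by blast
qed

end

section \<open>Order types bounded by the number of labels\<close>

lemma omega_pow_Cons_iff:
  "(m # xs, n # ys) \<in> omega_pow (Suc k) \<longleftrightarrow>
    m < n \<and> length xs = k \<and> length ys = k \<or> m = n \<and> (xs, ys) \<in> omega_pow k"
proof -
  have "Field (omega_pow k) = {xs. length xs = k}" using omega_pow_conv[of k] by blast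
  then show ?thesis by auto
qed

definition strict :: "'a rel \<Rightarrow> 'a \<Rightarrow> 'a \<Rightarrow> bool" where
  "strict r x y \<longleftrightarrow> (x, y) \<in> r \<and> x \<noteq> y"

text \<open>For a least element the condition is vacuous and the value is all of \<open>L\<close>;
  this is why later assumptions speak of elements with a predecessor.\<close>

definition cofinal_labels :: "'a rel \<Rightarrow> ('a \<Rightarrow> 'l) \<Rightarrow> 'l set \<Rightarrow> 'a \<Rightarrow> 'l set" where
  "cofinal_labels r lab L y = {l \<in> L. \<forall>b. strict r b y \<longrightarrow> (\<exists>x. strict r b x \<and> strict r x y \<and> lab x = l)}"

text \<open>
  A supremum of a copy of \<open>\<omega>\<^sup>i\<close> has at least \<open>i\<close> cofinal labels: among the suprema of the
  \<open>\<omega>\<close> many copies of \<open>\<omega>\<^sup>i\<^sup>-\<^sup>1\<close>, infinitely many share their cofinal labels and their own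
  label, which is not one of those.
\<close>

lemma card_cofinal_labels:
  fixes r :: "'a rel"
  assumes r: "Well_order r" and L: "finite L" "lab ` Field r \<subseteq> L"
    and own: "\<And>x y. strict r x y \<Longrightarrow> lab y \<notin> cofinal_labels r lab L y"
    and f: "\<And>xs. length xs = i \<Longrightarrow> f xs \<in> Field r"
      "\<And>xs ys. (xs, ys) \<in> omega_pow i \<Longrightarrow> xs \<noteq> ys \<Longrightarrow> strict r (f xs) (f ys)"
    and y: "\<And>xs. length xs = i \<Longrightarrow> strict r (f xs) y"
      "\<And>z. z \<in> Field r \<Longrightarrow> (\<And>xs. length xs = i \<Longrightarrow> strict r (f xs) z) \<Longrightarrow> \<not> strict r z y"
  shows "i \<le> card (cofinal_labels r lab L y)"
  using f y
proof (induction i arbitrary: f y)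
  case (Suc i)
  have lin: "trans r" "antisym r" "total_on (Field r) r" "wf (r - Id)" "Refl r"
    using r by (auto simp: well_order_on_def linear_order_on_def partial_order_on_def preorder_on_def)
  have tr: "strict r a c" if "strict r a b" "strict r b c" for a b c
    using that lin(1,2) unfolding strict_def by (metis antisymD transD)
  have irr: "\<not> strict r a a" for a by (simp add: strict_def)
  have tot: "strict r a b \<or> a = b \<or> strict r b a" if "a \<in> Field r" "b \<in> Field r" for a b
    using lin(3) that unfolding strict_def total_on_def by blast
  have fld: "a \<in> Field r \<and> b \<in> Field r" if "strict r a b" for a b
    using that by (auto simp: strict_def Field_def)
  have succ: "strict r (f (m # xs)) (f (n # ys))" if "m < n" "length xs = i" "length ys = i" for m n xs ys
    by (rule Suc.prems(2)) (use that in \<open>auto simp: omega_pow_Cons_iff simp del: omega_pow.simps\<close>)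
  \<comment> \<open>Strict upper bounds of the copy with index \<open>m\<close>; \<open>s m\<close>
    below is the least one. For \<open>i = 0\<close> the copy is one point and \<open>s m\<close>
    its successor.\<close>
  define U where "U m = {z \<in> Field r. \<forall>xs. length xs = i \<longrightarrow> strict r (f (m # xs)) z}" for m
  have "\<exists>s. s \<in> U m \<and> (\<forall>z\<in>U m. \<not> strict r z s)" for m
  proof -
    \<comment> \<open>The first point of the next copy is such a bound.\<close>
    have "f (Suc m # replicate i 0) \<in> U m" using Suc.prems(1) succ by (simp add: U_def)
    then obtain s where s: "s \<in> U m" "\<forall>z. (z, s) \<in> r - Id \<longrightarrow> z \<notin> U m"
      using lin(4) unfolding wf_eq_minimal by blast
    from s(2) have "\<forall>z\<in>U m. \<not> strict r z s" by (auto simp: strict_def)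
    with s(1) show ?thesis by blast
  qed
  then have "\<forall>m. \<exists>s. s \<in> U m \<and> (\<forall>z\<in>U m. \<not> strict r z s)" ..
  from choice[OF this] obtain s where sU: "\<And>m. s m \<in> U m" "\<And>m z. z \<in> U m \<Longrightarrow> \<not> strict r z (s m)"
    by auto
  have s: "s m \<in> Field r" "length xs = i \<Longrightarrow> strict r (f (m # xs)) (s m)" for m xs
    using sU(1)[of m] by (auto simp: U_def)
  have s_min: "\<not> strict r z (s m)" if "z \<in> Field r" "\<And>xs. length xs = i \<Longrightarrow> strict r (f (m # xs)) z" for m z
    by (rule sU(2)) (use that in \<open>simp add: U_def\<close>)
  have IH: "i \<le> card (cofinal_labels r lab L (s m))" for m
  proof (rule Suc.IH[where f = "\<lambda>xs. f (m # xs)"])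
    fix xs ys :: "nat list" assume "(xs, ys) \<in> omega_pow i" "xs \<noteq> ys"
    then show "strict r (f (m # xs)) (f (m # ys))"
      by (intro Suc.prems(2)) (auto simp: omega_pow_Cons_iff simp del: omega_pow.simps)
  qed (use Suc.prems(1) s s_min in auto)
  have own_s: "lab (s m) \<notin> cofinal_labels r lab L (s m)" for m
    using own[OF s(2)[of "replicate i 0"]] by simp
  have s_y: "strict r (s m) y" for m
  proof -
    let ?g = "f (Suc m # replicate i 0)"
    have "\<not> strict r ?g (s m)" by (rule s_min) (use succ Suc.prems(1) in auto)
    moreover have "strict r ?g y" "?g \<in> Field r" using Suc.prems by simp_all
    ultimately show ?thesis using tot[of ?g "s m"] s(1) tr by metis
  qed
  \<comment> \<open>Pigeonhole: the pairs of own label and cofinal labels range over a finite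
    set.\<close>
  have "finite (range (\<lambda>m. (lab (s m), cofinal_labels r lab L (s m))))"
    by (rule finite_subset[of _ "L \<times> Pow L"]) (use L s(1) in \<open>auto simp: cofinal_labels_def\<close>)
  from pigeonhole_infinite[OF _ this] obtain m0 where
    inf: "infinite {m. lab (s m) = lab (s m0) \<and> cofinal_labels r lab L (s m) = cofinal_labels r lab L (s m0)}"
    by auto
  let ?l = "lab (s m0)" and ?K = "cofinal_labels r lab L (s m0)"
  \<comment> \<open>As \<open>y\<close> is the least strict bound of all copies, the points
    \<open>s m\<close> of the infinite class are cofinal below \<open>y\<close>.\<close>
  have far: "\<exists>m. strict r b (s m) \<and> lab (s m) = ?l \<and> cofinal_labels r lab L (s m) = ?K"
    if b: "strict r b y" for b
  proof -
    obtain xs where xs: "length xs = Suc i" "\<not> strict r (f xs) b"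
      using Suc.prems(4)[of b] fld[OF b] b by blast
    then obtain n xs' where "xs = n # xs'" "length xs' = i" by (cases xs) auto
    from inf obtain m where m: "m > n" "lab (s m) = ?l" "cofinal_labels r lab L (s m) = ?K"
      unfolding finite_nat_set_iff_bounded_le by (auto simp: not_le)
    have "strict r (f xs) (f (m # xs'))" using \<open>xs = _\<close> \<open>length xs' = i\<close> m(1) succ by simp
    moreover have "strict r (f (m # xs')) (s m)" using s(2) \<open>length xs' = i\<close> by blast
    moreover have "b = f xs \<or> strict r b (f xs)" using tot[of b "f xs"] xs fld[OF b] Suc.prems(1) by blast
    ultimately have "strict r b (s m)" using tr by blast
    with m show ?thesis by blast
  qed
  \<comment> \<open>The common label recurs at the points \<open>s m\<close>, the labels of
    \<open>?K\<close> recur arbitrarily close below them. By \<open>own_s\<close> the former is not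
    in \<open>?K\<close>, which raises the count by one.\<close>
  have "insert ?l ?K \<subseteq> cofinal_labels r lab L y"
  proof (intro subsetI)
    fix l assume l: "l \<in> insert ?l ?K"
    have "\<exists>x. strict r b x \<and> strict r x y \<and> lab x = l" if "strict r b y" for b
    proof -
      from far[OF that] obtain m where m: "strict r b (s m)" "lab (s m) = ?l"
        "cofinal_labels r lab L (s m) = ?K" by blast
      show ?thesis
      proof (cases "l = ?l")
        case True then show ?thesis using m s_y by blast
      next
        case False
        with l m(3) have "l \<in> cofinal_labels r lab L (s m)" by simp
        with m(1) obtain x where "strict r b x" "strict r x (s m)" "lab x = l"
          unfolding cofinal_labels_def by blast
        then show ?thesis using tr s_y by blast
      qed
    qed
    moreover have "l \<in> L" using l L(2) s(1) by (auto simp: cofinal_labels_def)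
    ultimately show "l \<in> cofinal_labels r lab L y" by (auto simp: cofinal_labels_def)
  qed
  moreover have fin: "finite (cofinal_labels r lab L z)" for z using L by (simp add: cofinal_labels_def)
  ultimately have "card (insert ?l ?K) \<le> card (cofinal_labels r lab L y)" by (intro card_mono)
  then show ?case using IH[of m0] own_s[of m0] fin by simp
qed simp

text \<open>Otherwise some element sits at position omega to the power \<open>card L\<close>. It has
  at least \<open>card L\<close> cofinal labels, hence all of \<open>L\<close>, its own label among
  them.\<close>

lemma ordLeq_omega_pow:
  fixes r :: "'a rel"
  assumes r: "Well_order r" and L: "finite L" "lab ` Field r \<subseteq> L"
    and own: "\<And>x y. strict r x y \<Longrightarrow> lab y \<notin> cofinal_labels r lab L y"
  shows "r \<le>o omega_pow (card L)"
proof (rule ccontr)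
  assume "\<not> r \<le>o omega_pow (card L)"
  then have "omega_pow (card L) <o r" using r Well_order_omega_pow ordLess_or_ordLeq by blast
  then obtain a where a: "a \<in> Field r" "omega_pow (card L) =o Restr r (underS r a)"
    using ordLess_iff_ordIso_Restr[OF r Well_order_omega_pow] by blast
  then obtain f where f: "iso (omega_pow (card L)) (Restr r (underS r a)) f"
    by (auto simp: ordIso_def)
  have F: "Field (omega_pow (card L)) = {xs. length xs = card L}" using omega_pow_conv by blast
  have f_mono: "strict r (f xs) (f ys)" if "(xs, ys) \<in> omega_pow (card L)" "xs \<noteq> ys" for xs ys
  proof -
    have "xs \<in> Field (omega_pow (card L))" "ys \<in> Field (omega_pow (card L))"
      using that(1) by (auto simp: Field_def)
    then show ?thesis
      using f that unfolding iso_iff2 bij_betw_def inj_on_def strict_def by blast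
  qed
  have f_a: "strict r (f xs) a" if "length xs = card L" for xs
  proof -
    have "f xs \<in> Field (Restr r (underS r a))"
      using f that F unfolding iso_iff2 bij_betw_def by blast
    then have "f xs \<in> underS r a" by (auto simp: Field_def)
    then show ?thesis by (auto simp: underS_def strict_def)
  qed
  let ?U = "{z \<in> Field r. \<forall>xs. length xs = card L \<longrightarrow> strict r (f xs) z}"
  have "wf (r - Id)" "a \<in> ?U" using r a(1) f_a by (auto simp: well_order_on_def)
  then obtain y where y: "y \<in> ?U" "\<forall>z. (z, y) \<in> r - Id \<longrightarrow> z \<notin> ?U"
    unfolding wf_eq_minimal by meson
  have "card L \<le> card (cofinal_labels r lab L y)"
  proof (rule card_cofinal_labels[OF r L own])
    show "f xs \<in> Field r" if "length xs = card L" for xs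
      using f_a[OF that] by (auto simp: strict_def Field_def)
    show "\<not> strict r z y" if "z \<in> Field r" "\<And>xs. length xs = card L \<Longrightarrow> strict r (f xs) z" for z
      using y(2) that by (auto simp: strict_def)
  qed (use f_mono y(1) in auto)
  moreover have "lab y \<notin> cofinal_labels r lab L y" "lab y \<in> L"
    using own[of "f (replicate (card L) 0)" y] y(1) L(2) by auto
  then have "cofinal_labels r lab L y \<subset> L" by (auto simp: cofinal_labels_def)
  then have "card (cofinal_labels r lab L y) < card L" using L(1) by (rule psubset_card_mono[rotated])
  ultimately show False by simp
qed

section \<open>Colored ordinals\<close>

lemma colored_ordinal_substr:
  assumes "colored_ordinal d S" "X \<subseteq> carr S"
  shows "colored_ordinal d (substr S X)"
proof -
  have wo: "well_order_on (carr S) (ordr S)" using assms(1) by (simp add: colored_ordinal_def)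
  then have "Field (ordr S) = carr S" "Well_order (ordr S)" using well_order_on_Well_order by blast+
  then have "well_order_on X (Restr (ordr S) X)" using well_order_on_Restr assms(2) by metis
  moreover have "carr S \<inter> X = X" using assms(2) by blast
  ultimately show ?thesis
    using assms unfolding colored_ordinal_def disjoint_family_on_def
    by (simp add: substr_def) blast
qed

lemma substr_substr: "substr (substr S X) Y = substr S (X \<inter> Y)"
  by (auto simp: substr_def)

lemma below_substr: "a \<in> X \<Longrightarrow> X \<subseteq> carr S \<Longrightarrow> below (substr S X) a = substr S {x \<in> X. lt S x a}"
  unfolding below_def substr_substr by (rule arg_cong[where f = "substr S"]) auto

lemma above_substr: "a \<in> X \<Longrightarrow> X \<subseteq> carr S \<Longrightarrow> above (substr S X) a = substr S {x \<in> X. lt S a x}"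
  unfolding above_def substr_substr by (rule arg_cong[where f = "substr S"]) auto

lemma color_of_substr: "a \<in> X \<Longrightarrow> color_of d (substr S X) a = color_of d S a"
  by (simp add: color_of_def)

lemma substr_carr_below: "below S a = substr S {x \<in> carr S. lt S x a}"
  and substr_carr_above: "above S a = substr S {x \<in> carr S. lt S a x}"
  by (simp_all add: below_def above_def)

text \<open>Rank 0 sentences have no variables and hence no atoms, so all rank 0 types coincide. The
  successor step is \<open>char_sentence_Suc_iff\<close>, with the parts below and above a point
  rewritten as substructures of \<open>A\<close>.\<close>

lemma typed_chain_colored_ordinal:
  fixes A :: "'a colored"
  assumes A: "colored_ordinal d A"
  shows "typed_chain (carr A) (lt A) (color_of d A) (\<lambda>n X. char_sentence d n (substr A X))"
proof
  have wo: "well_order_on (carr A) (ordr A)" using A by (simp add: colored_ordinal_def)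
  then have lin: "linear_order_on (carr A) (ordr A)" by (simp add: well_order_on_def)
  show "\<not> lt A a a" for a using lt_linear(1)[OF lin] .
  show "lt A a b \<Longrightarrow> lt A b c \<Longrightarrow> lt A a c" for a b c using lt_linear(2)[OF lin] .
  show "a \<in> carr A \<Longrightarrow> b \<in> carr A \<Longrightarrow> lt A a b \<or> a = b \<or> lt A b a" for a b
    using lt_linear(3)[OF lin] .
  show "\<exists>m\<in>X. \<forall>x\<in>X. \<not> lt A x m" if "X \<subseteq> carr A" "X \<noteq> {}" for X
  proof -
    have "wf (ordr A - Id)" using wo by (simp add: well_order_on_def)
    with that(2) obtain m where "m \<in> X" "\<forall>x. (x, m) \<in> ordr A - Id \<longrightarrow> x \<notin> X"
      unfolding wf_eq_minimal by blast
    then show ?thesis by (auto simp: lt_def)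
  qed
  show "char_sentence d 0 (substr A X) = char_sentence d 0 (substr A Y)" for X Y
    unfolding char_sentence_def by (rule hintikka_0_if_agree) (simp_all add: agree_def)
  show "finite ((\<lambda>X. char_sentence d n (substr A X)) ` Pow (carr A))" for n
    by (rule finite_subset[OF _ finite_hintikka[of d n 0]]) (auto simp: char_sentence_def)
  show "finite (color_of d A ` carr A)"
    by (rule finite_subset[of _ "{..<d}"]) (use color_of[OF A] in auto)
  show "char_sentence d (Suc n) (substr A X) = char_sentence d (Suc n) (substr A Y) \<longleftrightarrow>
      (\<forall>a\<in>X. \<exists>b\<in>Y. color_of d A a = color_of d A b \<and>
        char_sentence d n (substr A {x \<in> X. lt A x a}) = char_sentence d n (substr A {y \<in> Y. lt A y b}) \<and>
        char_sentence d n (substr A {x \<in> X. lt A a x}) = char_sentence d n (substr A {y \<in> Y. lt A b y})) \<and>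
      (\<forall>b\<in>Y. \<exists>a\<in>X. color_of d A a = color_of d A b \<and>
        char_sentence d n (substr A {x \<in> X. lt A x a}) = char_sentence d n (substr A {y \<in> Y. lt A y b}) \<and>
        char_sentence d n (substr A {x \<in> X. lt A a x}) = char_sentence d n (substr A {y \<in> Y. lt A b y}))"
    if X: "X \<subseteq> carr A" and Y: "Y \<subseteq> carr A" for X Y n
  proof -
    have char: "character d n (substr A Z) a = (color_of d A a,
        char_sentence d n (substr A {x \<in> Z. lt A x a}), char_sentence d n (substr A {x \<in> Z. lt A a x}))"
      if "Z \<subseteq> carr A" "a \<in> Z" for Z a
      using that by (simp add: character_def color_of_substr below_substr above_substr)
    have carr: "carr (substr A Z) = Z" if "Z \<subseteq> carr A" for Z using that by auto
    show ?thesis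
      unfolding char_sentence_Suc_iff[OF colored_ordinal_substr[OF A X] colored_ordinal_substr[OF A Y]]
        characters_def image_eq_image_iff carr[OF X] carr[OF Y]
      by (simp add: char[OF X] char[OF Y] cong: ball_cong bex_cong)
  qed
qed

lemma finite_characters:
  fixes S :: "'a colored"
  assumes "colored_ordinal d S"
  shows "finite (characters d n S)"
proof (rule finite_subset)
  let ?H = "{hintikka d n T as |(T :: 'a colored) as. length as = 0}"
  show "characters d n S \<subseteq> {..<d} \<times> ?H \<times> ?H"
    using color_of[OF assms] by (auto simp: characters_def character_def char_sentence_def)
qed (intro finite_cartesian_product finite_lessThan finite_hintikka)

theorem theorem7:
  fixes d q k :: nat and A :: "'a colored"
  assumes "d \<ge> 1" and "q \<ge> 2"
    and "colored_ordinal d A"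
    and "k = card (characters d (q - 1) A)"
  shows "\<exists>B :: nat colored.
           colored_ordinal d B \<and> equiv_q d q B A \<and> ordr B \<le>o omega_pow k"
proof -
  define p where "p = q - 1"
  have q: "q = Suc p" using assms(2) by (simp add: p_def)
  interpret typed_chain "carr A" "lt A" "color_of d A" "\<lambda>n X. char_sentence d n (substr A X)"
    using assms(3) by (rule typed_chain_colored_ordinal)
  have chr: "chr p = character d p A"
    by (rule ext) (simp add: chr_def character_def bel_def abv_def substr_carr_below substr_carr_above)
  have chars: "chr p ` carr A = characters d p A" by (simp add: chr characters_def)
  have "finite (chr p ` carr A)" unfolding chars using finite_characters[OF assms(3)] .
  from ex_thin_subset[OF this] obtain J where J: "J \<subseteq> carr A" "countable J"
    and ty: "char_sentence d (Suc p) (substr A J) = char_sentence d (Suc p) (substr A (carr A))"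
    and lim: "\<forall>y\<in>J. \<not> own_limit p J y" by blast
  define S where "S = substr A J"
  have S: "colored_ordinal d S" unfolding S_def by (rule colored_ordinal_substr[OF assms(3) J(1)])
  have carr_S: "carr S = J" using J(1) by (auto simp: S_def)
  have wo: "well_order_on J (ordr S)" using S by (simp add: colored_ordinal_def carr_S)
  then have WO: "Well_order (ordr S)" and Field_S: "Field (ordr S) = J"
    using well_order_on_Well_order by blast+
  \<comment> \<open>Countability of \<open>J\<close> allows a copy with natural numbers as
    elements.\<close>
  let ?g = "to_nat_on J"
  have g: "inj_on ?g J" using J(2) by (rule inj_on_to_nat_on)
  define B where "B = \<lparr>carr = ?g ` J, ordr = dir_image (ordr S) ?g, colr = (\<lambda>i. ?g ` (colr S i \<inter> J))\<rparr>"
  have WB: "Well_order (ordr B)" "Field (ordr B) = ?g ` J"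
    using Well_order_dir_image[OF WO] g by (simp_all add: B_def dir_image_Field Field_S)
  have colr_S: "colr S i \<subseteq> J" if "i < d" for i
    using S that by (auto simp: colored_ordinal_def carr_S)
  have B: "colored_ordinal d B"
    unfolding colored_ordinal_def
  proof (intro conjI)
    show "well_order_on (carr B) (ordr B)" using WB by (simp add: B_def)
    have "(\<Union>i<d. colr S i) = J" using S by (simp add: colored_ordinal_def carr_S)
    then show "(\<Union>i<d. colr B i) = carr B" by (auto simp: B_def)
    show "disjoint_family_on (colr B) {..<d}"
      using S g unfolding colored_ordinal_def disjoint_family_on_def B_def
      by (auto dest!: inj_onD[OF g])
  qed
  have "hintikka d q S [] = hintikka d q B (map ?g [])"
  proof (rule hintikka_isomorphic)
    show "bij_betw ?g (carr S) (carr B)" using g by (simp add: bij_betw_def B_def carr_S)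
    show "lt B (?g x) (?g y) \<longleftrightarrow> lt S x y" if "x \<in> carr S" "y \<in> carr S" for x y
      using that g Field_S by (auto simp: lt_def B_def dir_image_def carr_S Field_def inj_on_eq_iff dest: inj_onD)
    show "?g x \<in> colr B i \<longleftrightarrow> x \<in> colr S i" if "x \<in> carr S" for i x
      using that g by (auto simp: B_def carr_S dest: inj_onD)
  qed simp
  then have "char_sentence d q B = char_sentence d q S" by (simp add: char_sentence_def)
  also have "\<dots> = char_sentence d q A"
  proof -
    \<comment> \<open>The two records may differ in color classes with index from \<open>d\<close>
      on, hence the identity is used as an isomorphism.\<close>
    have "hintikka d q (substr A (carr A)) [] = hintikka d q A (map id [])"
      by (rule hintikka_isomorphic) auto
    with ty show ?thesis by (simp add: S_def q char_sentence_def del: hintikka.simps)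
  qed
  finally have equiv: "equiv_q d q B A" by (simp add: char_sentence_eq_iff)
  \<comment> \<open>The labels are the characters in \<open>A\<close>, not those in
    \<open>J\<close>: \<open>own_limit\<close> refers to them, and there are \<open>k\<close> of
    them.\<close>
  have "ordr S \<le>o omega_pow (card (characters d p A))"
  proof (rule ordLeq_omega_pow[where lab = "character d p A"])
    show "character d p A ` Field (ordr S) \<subseteq> characters d p A"
      using J(1) by (auto simp: Field_S characters_def)
    have strict: "strict (ordr S) x y \<longleftrightarrow> x \<in> J \<and> y \<in> J \<and> lt A x y" for x y
      using J(1) by (auto simp: strict_def S_def substr_def lt_def)
    show "character d p A y \<notin> cofinal_labels (ordr S) (character d p A) (characters d p A) y"
      if "strict (ordr S) x y" for x y
    proof
      assume "character d p A y \<in> cofinal_labels (ordr S) (character d p A) (characters d p A) y"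
      then have "own_limit p J y"
        using that unfolding own_limit_def cofinal_labels_def strict chr bel_def by blast
      then show False using lim that by (simp add: strict)
    qed
  qed (use WO finite_characters[OF assms(3)] in auto)
  moreover have "ordr B =o ordr S"
    using ordIso_symmetric[OF dir_image_ordIso[OF WO]] g by (simp add: B_def Field_S)
  ultimately have "ordr B \<le>o omega_pow k"
    unfolding assms(4) p_def by (rule ordIso_ordLeq_trans[rotated])
  with B equiv show ?thesis by blast
qed

end
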